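(* Let $\mathbf K$ be a $\mu$-AEC and let $\downarrow$ be an invariant, transitive independence relation on $\mathbf K$ with existence, uniqueness, and right local character. If $\mathbf K$ has chain bounds, or more generally if $\downarrow$ is symmetric, then $\mathbf K$ does not have the order property.
   Context: **$\mu$-AECs.** Let $\mu$ be a regular cardinal. A ($\mu$-ary) abstract class is a pair $\mathbf K=(K,\le_{\mathbf K})$ where $K$ is a class of structures in a fixed $\mu$-ary vocabulary $\tau(\mathbf K)$ (symbols of arity $<\mu$), $\le_{\mathbf K}$ is a partial order on $K$ refining the substructure relation $\subseteq$, and both are closed under isomorphism. $UM$ is the universe of $M$. A $\mu$-AEC is an abstract class satisfying: (Coherence) $M_0\subseteq M_1\le_{\mathbf K}M_2$ and $M_0\le_{\mathbf K}M_2$ imply $M_0\le_{\mathbf K}M_1$; (Chain axioms) for any $\mu$-directed system $\langle M_i:i\in I\rangle$ in $\mathbf K$, $M=\bigcup_iM_i$ is in $\mathbf K$, $M_i\le_{\mathbf K}M$ for all $i$, and if $M_i\le_{\mathbf K}N$ for all $i$ then $M\le_{\mathbf K}N$; (LST axiom) there is a cardinal $\lambda=\lambda^{<\mu}\ge|\tau(\mathbf K)|+\mu$ such that for any $M\in\mathbf K$ and $A\subseteq UM$ there is $M_0\le_{\mathbf K}M$ with $A\subseteq UM_0$ and $|UM_0|\le|A|^{<\mu}+\lambda$. A $\mathbf K$-embedding $f:M\to N$ is an isomorphism of $M$ onto some $f[M]\le_{\mathbf K}N$. $\mathbf K$ is viewed as a category whose morphisms are the $\mathbf K$-embeddings. $\mathbf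 K$ has chain bounds if for every ordinal $\delta$ and every $\le_{\mathbf K}$-increasing chain $\langle M_i:i<\delta\rangle$ there is $M\in\mathbf K$ with $M_i\le_{\mathbf K}M$ for all $i<\delta$. **Independence relations.** A span is a pair of morphisms $(f_1:M_0\to M_1,\ f_2:M_0\to M_2)$. An amalgam of it is a pair $(g_1:M_1\to N,\ g_2:M_2\to N)$ with $g_1f_1=g_2f_2$; then $(f_1,f_2,g_1,g_2)$ is an amalgamation diagram. For two amalgams $(g_1^a,g_2^a)$ (into $N^a$), $(g_1^b,g_2^b)$ (into $N^b$) of the same span, write $(f_1,f_2,g_1^a,g_2^a)\sim^*(f_1,f_2,g_1^b,g_2^b)$ if there are $N_*$, $g^a:N^a\to N_*$, $g^b:N^b\to N_*$ with $g^ag_\ell^a=g^bg_\ell^b$ for $\ell=1,2$; $\sim$ is the transitive closure of $\sim^*$. An independence relation $\downarrow$ is a class of amalgamation diagrams closed under $\sim$; members are called independent. It is invariant if it is closed under isomorphism of amalgamation diagrams. The dual: $\downarrow^d(f_1,f_2,g_1,g_2)$ iff $\downarrow(f_2,f_1,g_2,g_1)$; symmetric: $\downarrow=\downarrow^d$. Existence: every span has an amalgam forming an independent diagram with it. Uniqueness: any two independent diagrams with the same span are $\sim$-related. Right transitive: $\downarrow(f_{0,1},f_{0,2},f_{1,3},f_{2,3})$ and $\downarrow(f_{2,3},f_{2,4},f_{3,5},f_{4,5})$ (with $f_{i,j}:M_i\to M_j$) imply $\downarrow(f_{0,1},f_{2,4}f_{0,2},f_{3,5}f_{1,3},f_{4,5})$;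 left transitive: $\downarrow^d$ is right transitive; transitive: both. Write $M_1\downarrow_{M_0}^{M_3}M_2$ if $M_0\le_{\mathbf K}M_\ell\le_{\mathbf K}M_3$ ($\ell=1,2$) and the square of inclusions is independent. Write $A\,\overline{\downarrow}_{N_0}^{N_3}B$ if $N_0\le_{\mathbf K}N_3$, $A\cup B\subseteq UN_3$, and there are $M_1,M_2,M_3$ with $A\subseteq UM_1$, $B\subseteq UM_2$, $N_3\le_{\mathbf K}M_3$ and $M_1\downarrow_{N_0}^{M_3}M_2$. **Galois types, local character, order property.** For $B\subseteq UN$ and a sequence $\bar a$ from $N$, $\mathrm{gtp}(\bar a/B;N)$ is the class of $(\bar a,B,N)$ under the transitive closure of the relation: $(\bar a,B,N)$ and $(\bar a',B,N')$ are related iff there are $\mathbf K$-embeddings $g:N\to\bar N$, $g':N'\to\bar N$ with $g\restriction B=g'\restriction B$ and $g(\bar a)=g'(\bar a')$. $\mathrm{gS}^\alpha(M)$ is the set of $\mathrm{gtp}(\bar a/M;N)$ with $M\le_{\mathbf K}N$ and $\bar a$ of length $\alpha$ in $N$. $\mathrm{gtp}(\bar a/B;N_3)$ does not fork over $N_0$ if $\mathrm{ran}(\bar a)\,\overline{\downarrow}_{N_0}^{N_3}B$. $\downarrow$ has right local character if for each cardinal $\alpha$ there is a cardinal $\lambda$ such that for every $M\in\mathbf K$ and $p\in\mathrm{gS}^\alpha(M)$ there is $M_0\le_{\mathbf K}M$ with $|UM_0|\le\lambda$ and $p$ not forking over $M_0$. $\mathbf K$ has the $\alpha$-order property of length $\theta$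 if there are $M\in\mathbf K$ and a sequence $\langle\bar a_i:i<\theta\rangle$ of $\alpha$-tuples from $UM$ such that for all $i_0<j_0<\theta$ and $i_1<j_1<\theta$, $\mathrm{gtp}(\bar a_{i_0}\bar a_{j_0}/\emptyset;M)\ne\mathrm{gtp}(\bar a_{j_1}\bar a_{i_1}/\emptyset;M)$. $\mathbf K$ has the order property if there is $\alpha$ such that for all $\theta$, $\mathbf K$ has the $\alpha$-order property of length $\theta$. *)

theory Defs
  imports Main "HOL-Library.FuncSet"
begin

unbundle cardinal_syntax

section \<open>The set-theoretic universe\<close>

text \<open>
  The ambient universe of sets is modelled by a type \<open>'u\<close> whose cardinality is (uncountable and)
  strongly inaccessible. The \<^emph>\<open>sets\<close> are the subsets of \<open>'u\<close> of smaller cardinality, and the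
  \<^emph>\<open>classes\<close> (of structures, of diagrams, ...) are arbitrary Isabelle sets and predicates.
  Ordinals and cardinals are represented by well-orders and cardinal orders on small subsets
  of \<open>'u\<close>; the elements of an ordinal \<open>r\<close> form \<open>Field r\<close>, and \<open>underS r x\<close> is
  the set of elements below \<open>x\<close>.
\<close>

definition inaccessible_universe :: "'u itself \<Rightarrow> bool" where
  "inaccessible_universe _ \<longleftrightarrow>
     natLeq <o |UNIV :: 'u set| \<and>
     regularCard |UNIV :: 'u set| \<and>
     (\<forall>A :: 'u set. |A| <o |UNIV :: 'u set| \<longrightarrow> |Pow A| <o |UNIV :: 'u set| )"

definition small :: "'u set \<Rightarrow> bool" where
  "small A \<longleftrightarrow> |A| <o |UNIV :: 'u set|"

definition is_ordinal :: "'u rel \<Rightarrow> bool" where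
  "is_ordinal r \<longleftrightarrow> Well_order r \<and> small (Field r)"

definition is_cardinal :: "'u rel \<Rightarrow> bool" where
  "is_cardinal r \<longleftrightarrow> Card_order r \<and> small (Field r)"

definition is_regular_cardinal :: "'u rel \<Rightarrow> bool" where
  "is_regular_cardinal r \<longleftrightarrow> is_cardinal r \<and> cinfinite r \<and> regularCard r"

text \<open>The sequences in \<open>A\<close> of length \<open><\<mu>\<close>; their number is \<open>|A|\<^sup><\<^sup>\<mu>\<close>.\<close>

definition seqs_less :: "'u rel \<Rightarrow> 'u set \<Rightarrow> ('u \<times> ('u \<Rightarrow> 'u)) set" where
  "seqs_less \<mu> A = (SIGMA x : Field \<mu>. underS \<mu> x \<rightarrow>\<^sub>E A)"


section \<open>Structures and \<open>\<mu>\<close>-AECs\<close>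

record ('s, 'u) struct =
  univ :: "'u set"
  rel_in :: "'s \<Rightarrow> ('u \<Rightarrow> 'u) set"
  fun_in :: "'s \<Rightarrow> ('u \<Rightarrow> 'u) \<Rightarrow> 'u"

text \<open>
  The arity of a symbol is an ordinal \<open><\<mu>\<close>, given as an element \<open>x\<close> of \<open>Field \<mu>\<close>;
  the argument tuples are indexed by \<open>underS \<mu> x\<close>.
\<close>

record ('s, 'u) abstract_class =
  mu :: "'u rel"
  rel_syms :: "'s set"
  fun_syms :: "'s set"
  arity :: "'s \<Rightarrow> 'u"
  models :: "('s, 'u) struct set"
  le :: "('s, 'u) struct \<Rightarrow> ('s, 'u) struct \<Rightarrow> bool"

definition is_vocabulary :: "('s, 'u) abstract_class \<Rightarrow> bool" where
  "is_vocabulary K \<longleftrightarrow>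
     rel_syms K \<inter> fun_syms K = {} \<and> (\<forall>s \<in> rel_syms K \<union> fun_syms K. arity K s \<in> Field (mu K))"

definition arg_index :: "('s, 'u) abstract_class \<Rightarrow> 's \<Rightarrow> 'u set" where
  "arg_index K s = underS (mu K) (arity K s)"

definition tuples :: "('s, 'u) abstract_class \<Rightarrow> 's \<Rightarrow> 'u set \<Rightarrow> ('u \<Rightarrow> 'u) set" where
  "tuples K s A = (arg_index K s \<rightarrow>\<^sub>E A)"

text \<open>
  Interpretations are extensional (undefined outside the vocabulary and outside the tuples of the
  universe), so that equality of HOL records is equality of structures.
\<close>

definition is_struct :: "('s, 'u) abstract_class \<Rightarrow> ('s, 'u) struct \<Rightarrow> bool" where
  "is_struct K M \<longleftrightarrow>
     small (univ M) \<and>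
     rel_in M \<in> (\<Pi>\<^sub>E R \<in> rel_syms K. Pow (tuples K R (univ M))) \<and>
     fun_in M \<in> (\<Pi>\<^sub>E F \<in> fun_syms K. tuples K F (univ M) \<rightarrow>\<^sub>E univ M)"

definition substruct ::
    "('s, 'u) abstract_class \<Rightarrow> ('s, 'u) struct \<Rightarrow> ('s, 'u) struct \<Rightarrow> bool" where
  "substruct K M N \<longleftrightarrow>
     is_struct K M \<and> is_struct K N \<and> univ M \<subseteq> univ N \<and>
     (\<forall>R \<in> rel_syms K. rel_in M R = rel_in N R \<inter> tuples K R (univ M)) \<and>
     (\<forall>F \<in> fun_syms K. \<forall>t \<in> tuples K F (univ M). fun_in M F t = fun_in N F t)"

definition is_iso ::
    "('s, 'u) abstract_class \<Rightarrow> ('u \<Rightarrow> 'u) \<Rightarrow> ('s, 'u) struct \<Rightarrow> ('s, 'u) struct \<Rightarrow> bool" where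
  "is_iso K f M N \<longleftrightarrow>
     is_struct K M \<and> is_struct K N \<and> bij_betw f (univ M) (univ N) \<and>
     (\<forall>R \<in> rel_syms K. \<forall>t \<in> tuples K R (univ M).
        t \<in> rel_in M R \<longleftrightarrow> compose (arg_index K R) f t \<in> rel_in N R) \<and>
     (\<forall>F \<in> fun_syms K. \<forall>t \<in> tuples K F (univ M).
        f (fun_in M F t) = fun_in N F (compose (arg_index K F) f t))"

definition is_abstract_class :: "('s, 'u) abstract_class \<Rightarrow> bool" where
  "is_abstract_class K \<longleftrightarrow>
     is_vocabulary K \<and>
     (\<forall>M \<in> models K. is_struct K M) \<and>
     partial_order_on (models K) {(M, N). le K M N} \<and>
     (\<forall>M N. le K M N \<longrightarrow> substruct K M N) \<and>
     (\<forall>M N f. M \<in> models K \<and> is_iso K f M N \<longrightarrow> N \<in> models K) \<and>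
     (\<forall>M N M' N' f. le K M N \<and> is_iso K f N N' \<and> is_iso K f M M' \<and> substruct K M' N'
        \<longrightarrow> le K M' N')"

definition coherence :: "('s, 'u) abstract_class \<Rightarrow> bool" where
  "coherence K \<longleftrightarrow>
     (\<forall>M0 \<in> models K. \<forall>M1 \<in> models K. \<forall>M2 \<in> models K.
        substruct K M0 M1 \<and> le K M1 M2 \<and> le K M0 M2 \<longrightarrow> le K M0 M1)"

definition directed_system ::
    "('s, 'u) abstract_class \<Rightarrow> 'u set \<Rightarrow> 'u rel \<Rightarrow> ('u \<Rightarrow> ('s, 'u) struct) \<Rightarrow> bool" where
  "directed_system K I r M \<longleftrightarrow>
     small I \<and> partial_order_on I r \<and>
     (\<forall>A. A \<subseteq> I \<and> |A| <o mu K \<longrightarrow> (\<exists>b \<in> I. \<forall>a \<in> A. (a, b) \<in> r)) \<and>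
     (\<forall>i \<in> I. M i \<in> models K) \<and>
     (\<forall>(i, j) \<in> r. le K (M i) (M j))"

text \<open>
  In a \<open>\<mu>\<close>-directed system every tuple of the union lies in some \<open>M i\<close>, and
  all such \<open>i\<close> give the same value, so the description below is proper.
\<close>

definition union_struct ::
    "('s, 'u) abstract_class \<Rightarrow> 'u set \<Rightarrow> ('u \<Rightarrow> ('s, 'u) struct) \<Rightarrow> ('s, 'u) struct" where
  "union_struct K I M =
     \<lparr>univ = (\<Union>i\<in>I. univ (M i)),
      rel_in = (\<lambda>R \<in> rel_syms K. \<Union>i\<in>I. rel_in (M i) R),
      fun_in = (\<lambda>F \<in> fun_syms K. \<lambda>t \<in> tuples K F (\<Union>i\<in>I. univ (M i)).
        THE y. \<exists>i\<in>I. t \<in> tuples K F (univ (M i)) \<and> y = fun_in (M i) F t)\<rparr>"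

definition chain_axioms :: "('s, 'u) abstract_class \<Rightarrow> bool" where
  "chain_axioms K \<longleftrightarrow>
     (\<forall>I r M. directed_system K I r M \<longrightarrow>
        union_struct K I M \<in> models K \<and>
        (\<forall>i \<in> I. le K (M i) (union_struct K I M)) \<and>
        (\<forall>N \<in> models K. (\<forall>i \<in> I. le K (M i) N) \<longrightarrow> le K (union_struct K I M) N))"

definition LST_axiom :: "('s, 'u) abstract_class \<Rightarrow> bool" where
  "LST_axiom K \<longleftrightarrow>
     (\<exists>l :: 'u rel. is_cardinal l \<and> l =o |seqs_less (mu K) (Field l)| \<and>
          |rel_syms K \<union> fun_syms K| +c mu K \<le>o l \<and>
          (\<forall>M \<in> models K. \<forall>A \<subseteq> univ M.
             \<exists>M0. le K M0 M \<and> A \<subseteq> univ M0 \<and> |univ M0| \<le>o |seqs_less (mu K) A| +c l))"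

definition is_mu_AEC :: "('s, 'u) abstract_class \<Rightarrow> bool" where
  "is_mu_AEC K \<longleftrightarrow>
     is_regular_cardinal (mu K) \<and> is_abstract_class K \<and> coherence K \<and> chain_axioms K \<and> LST_axiom K"

definition chain_bounds :: "('s, 'u) abstract_class \<Rightarrow> bool" where
  "chain_bounds K \<longleftrightarrow>
     (\<forall>(\<delta> :: 'u rel) M. is_ordinal \<delta> \<and> (\<forall>i \<in> Field \<delta>. M i \<in> models K) \<and> (\<forall>(i, j) \<in> \<delta>. le K (M i) (M j))
        \<longrightarrow> (\<exists>N \<in> models K. \<forall>i \<in> Field \<delta>. le K (M i) N))"


section \<open>The category of \<open>\<^bold>K\<close>-embeddings\<close>

record ('s, 'u) arrow =
  src :: "('s, 'u) struct"
  tgt :: "('s, 'u) struct"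
  map_of_arrow :: "'u \<Rightarrow> 'u"

definition is_embedding ::
    "('s, 'u) abstract_class \<Rightarrow> ('u \<Rightarrow> 'u) \<Rightarrow> ('s, 'u) struct \<Rightarrow> ('s, 'u) struct \<Rightarrow> bool" where
  "is_embedding K f M N \<longleftrightarrow>
     M \<in> models K \<and> N \<in> models K \<and> f \<in> extensional (univ M) \<and> (\<exists>N'. le K N' N \<and> is_iso K f M N')"

definition is_arrow :: "('s, 'u) abstract_class \<Rightarrow> ('s, 'u) arrow \<Rightarrow> bool" where
  "is_arrow K f \<longleftrightarrow> is_embedding K (map_of_arrow f) (src f) (tgt f)"

definition comp_arrow ::
    "('s, 'u) arrow \<Rightarrow> ('s, 'u) arrow \<Rightarrow> ('s, 'u) arrow" (infixr \<open>\<cdot>\<close> 75) where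
  "g \<cdot> f =
     \<lparr>src = src f, tgt = tgt g,
      map_of_arrow = compose (univ (src f)) (map_of_arrow g) (map_of_arrow f)\<rparr>"

definition incl_arrow :: "('s, 'u) struct \<Rightarrow> ('s, 'u) struct \<Rightarrow> ('s, 'u) arrow" where
  "incl_arrow M N = \<lparr>src = M, tgt = N, map_of_arrow = (\<lambda>x \<in> univ M. x)\<rparr>"

definition iso_arrow :: "('s, 'u) abstract_class \<Rightarrow> ('s, 'u) arrow \<Rightarrow> bool" where
  "iso_arrow K f \<longleftrightarrow>
     is_arrow K f \<and>
     (\<exists>g. is_arrow K g \<and> src g = tgt f \<and> tgt g = src f \<and>
          g \<cdot> f = incl_arrow (src f) (src f) \<and> f \<cdot> g = incl_arrow (tgt f) (tgt f))"

definition is_span ::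
    "('s, 'u) abstract_class \<Rightarrow> ('s, 'u) arrow \<Rightarrow> ('s, 'u) arrow \<Rightarrow> bool" where
  "is_span K f1 f2 \<longleftrightarrow> is_arrow K f1 \<and> is_arrow K f2 \<and> src f1 = src f2"

definition is_amalgam ::
    "('s, 'u) abstract_class \<Rightarrow> ('s, 'u) arrow \<Rightarrow> ('s, 'u) arrow \<Rightarrow>
       ('s, 'u) arrow \<Rightarrow> ('s, 'u) arrow \<Rightarrow> bool" where
  "is_amalgam K f1 f2 g1 g2 \<longleftrightarrow>
     is_span K f1 f2 \<and> is_arrow K g1 \<and> is_arrow K g2 \<and>
     src g1 = tgt f1 \<and> src g2 = tgt f2 \<and> tgt g1 = tgt g2 \<and> g1 \<cdot> f1 = g2 \<cdot> f2"

definition sim_step ::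
    "('s, 'u) abstract_class \<Rightarrow> ('s, 'u) arrow \<Rightarrow> ('s, 'u) arrow \<Rightarrow>
       ('s, 'u) arrow \<times> ('s, 'u) arrow \<Rightarrow> ('s, 'u) arrow \<times> ('s, 'u) arrow \<Rightarrow> bool" where
  "sim_step K f1 f2 = (\<lambda>(ga1, ga2) (gb1, gb2).
     is_amalgam K f1 f2 ga1 ga2 \<and> is_amalgam K f1 f2 gb1 gb2 \<and>
     (\<exists>ga gb. is_arrow K ga \<and> is_arrow K gb \<and> src ga = tgt ga1 \<and> src gb = tgt gb1 \<and>
        tgt ga = tgt gb \<and> ga \<cdot> ga1 = gb \<cdot> gb1 \<and> ga \<cdot> ga2 = gb \<cdot> gb2))"

definition sim ::
    "('s, 'u) abstract_class \<Rightarrow> ('s, 'u) arrow \<Rightarrow> ('s, 'u) arrow \<Rightarrow>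
       ('s, 'u) arrow \<times> ('s, 'u) arrow \<Rightarrow> ('s, 'u) arrow \<times> ('s, 'u) arrow \<Rightarrow> bool" where
  "sim K f1 f2 = (sim_step K f1 f2)\<^sup>+\<^sup>+"


section \<open>Independence relations\<close>

type_synonym ('s, 'u) square_pred =
  "('s, 'u) arrow \<Rightarrow> ('s, 'u) arrow \<Rightarrow> ('s, 'u) arrow \<Rightarrow> ('s, 'u) arrow \<Rightarrow> bool"

definition independence_relation ::
    "('s, 'u) abstract_class \<Rightarrow> ('s, 'u) square_pred \<Rightarrow> bool" where
  "independence_relation K ind \<longleftrightarrow>
     (\<forall>f1 f2 g1 g2. ind f1 f2 g1 g2 \<longrightarrow> is_amalgam K f1 f2 g1 g2) \<and>
     (\<forall>f1 f2 g1 g2 h1 h2. ind f1 f2 g1 g2 \<and> sim K f1 f2 (g1, g2) (h1, h2) \<longrightarrow> ind f1 f2 h1 h2)"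

definition iso_diagrams ::
    "('s, 'u) abstract_class \<Rightarrow>
       ('s, 'u) arrow \<Rightarrow> ('s, 'u) arrow \<Rightarrow> ('s, 'u) arrow \<Rightarrow> ('s, 'u) arrow \<Rightarrow>
       ('s, 'u) arrow \<Rightarrow> ('s, 'u) arrow \<Rightarrow> ('s, 'u) arrow \<Rightarrow> ('s, 'u) arrow \<Rightarrow> bool" where
  "iso_diagrams K f1 f2 g1 g2 f1' f2' g1' g2' \<longleftrightarrow>
     is_amalgam K f1 f2 g1 g2 \<and> is_amalgam K f1' f2' g1' g2' \<and>
     (\<exists>h0 h1 h2 h3. iso_arrow K h0 \<and> iso_arrow K h1 \<and> iso_arrow K h2 \<and> iso_arrow K h3 \<and>
        src h0 = src f1 \<and> src h1 = tgt f1 \<and> src h2 = tgt f2 \<and> src h3 = tgt g1 \<and>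
        tgt h0 = src f1' \<and> tgt h1 = tgt f1' \<and> tgt h2 = tgt f2' \<and> tgt h3 = tgt g1' \<and>
        h1 \<cdot> f1 = f1' \<cdot> h0 \<and> h2 \<cdot> f2 = f2' \<cdot> h0 \<and> h3 \<cdot> g1 = g1' \<cdot> h1 \<and> h3 \<cdot> g2 = g2' \<cdot> h2)"

definition invariant :: "('s, 'u) abstract_class \<Rightarrow> ('s, 'u) square_pred \<Rightarrow> bool" where
  "invariant K ind \<longleftrightarrow>
     (\<forall>f1 f2 g1 g2 f1' f2' g1' g2'.
        ind f1 f2 g1 g2 \<and> iso_diagrams K f1 f2 g1 g2 f1' f2' g1' g2' \<longrightarrow> ind f1' f2' g1' g2')"

definition dual :: "('s, 'u) square_pred \<Rightarrow> ('s, 'u) square_pred" where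
  "dual ind = (\<lambda>f1 f2 g1 g2. ind f2 f1 g2 g1)"

definition symmetric :: "('s, 'u) square_pred \<Rightarrow> bool" where
  "symmetric ind \<longleftrightarrow> ind = dual ind"

definition has_existence :: "('s, 'u) abstract_class \<Rightarrow> ('s, 'u) square_pred \<Rightarrow> bool" where
  "has_existence K ind \<longleftrightarrow> (\<forall>f1 f2. is_span K f1 f2 \<longrightarrow> (\<exists>g1 g2. ind f1 f2 g1 g2))"

definition has_uniqueness :: "('s, 'u) abstract_class \<Rightarrow> ('s, 'u) square_pred \<Rightarrow> bool" where
  "has_uniqueness K ind \<longleftrightarrow>
     (\<forall>f1 f2 g1 g2 h1 h2. ind f1 f2 g1 g2 \<and> ind f1 f2 h1 h2 \<longrightarrow> sim K f1 f2 (g1, g2) (h1, h2))"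

definition right_transitive :: "('s, 'u) square_pred \<Rightarrow> bool" where
  "right_transitive ind \<longleftrightarrow>
     (\<forall>f01 f02 f13 f23 f24 f35 f45.
        ind f01 f02 f13 f23 \<and> ind f23 f24 f35 f45 \<longrightarrow> ind f01 (f24 \<cdot> f02) (f35 \<cdot> f13) f45)"

definition left_transitive :: "('s, 'u) square_pred \<Rightarrow> bool" where
  "left_transitive ind \<longleftrightarrow> right_transitive (dual ind)"

definition transitive :: "('s, 'u) square_pred \<Rightarrow> bool" where
  "transitive ind \<longleftrightarrow> left_transitive ind \<and> right_transitive ind"

text \<open>\<open>indep_models K ind M0 M1 M2 M3\<close> is \<open>M1 \<down> M2\<close> over \<open>M0\<close> inside \<open>M3\<close>;
  \<open>indep_sets K ind N0 A B N3\<close> is its extension to sets \<open>A\<close>, \<open>B\<close> over \<open>N0\<close> inside \<open>N3\<close>.\<close>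

definition indep_models ::
    "('s, 'u) abstract_class \<Rightarrow> ('s, 'u) square_pred \<Rightarrow> ('s, 'u) struct \<Rightarrow>
       ('s, 'u) struct \<Rightarrow> ('s, 'u) struct \<Rightarrow> ('s, 'u) struct \<Rightarrow> bool" where
  "indep_models K ind M0 M1 M2 M3 \<longleftrightarrow>
     le K M0 M1 \<and> le K M1 M3 \<and> le K M0 M2 \<and> le K M2 M3 \<and>
     ind (incl_arrow M0 M1) (incl_arrow M0 M2) (incl_arrow M1 M3) (incl_arrow M2 M3)"

definition indep_sets ::
    "('s, 'u) abstract_class \<Rightarrow> ('s, 'u) square_pred \<Rightarrow> ('s, 'u) struct \<Rightarrow>
       'u set \<Rightarrow> 'u set \<Rightarrow> ('s, 'u) struct \<Rightarrow> bool" where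
  "indep_sets K ind N0 A B N3 \<longleftrightarrow>
     le K N0 N3 \<and> A \<union> B \<subseteq> univ N3 \<and>
     (\<exists>M1 M2 M3. A \<subseteq> univ M1 \<and> B \<subseteq> univ M2 \<and> le K N3 M3 \<and> indep_models K ind N0 M1 M2 M3)"


section \<open>Galois types\<close>

text \<open>
  Sequences are indexed by a set \<open>J\<close> of arbitrary type \<open>'j\<close>, so that the concatenation of two
  sequences of length \<open>\<alpha>\<close> can be indexed by the disjoint sum of two copies of \<open>Field \<alpha>\<close>.
\<close>

definition gtp_step ::
    "('s, 'u) abstract_class \<Rightarrow> 'j set \<Rightarrow>
       ('j \<Rightarrow> 'u) \<times> 'u set \<times> ('s, 'u) struct \<Rightarrow> ('j \<Rightarrow> 'u) \<times> 'u set \<times> ('s, 'u) struct \<Rightarrow> bool" where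
  "gtp_step K J = (\<lambda>(a, B, N) (a', B', N').
     N \<in> models K \<and> N' \<in> models K \<and> B' = B \<and> B \<subseteq> univ N \<and> B \<subseteq> univ N' \<and>
     a \<in> J \<rightarrow>\<^sub>E univ N \<and> a' \<in> J \<rightarrow>\<^sub>E univ N' \<and>
     (\<exists>Nbar g g'. is_embedding K g N Nbar \<and> is_embedding K g' N' Nbar \<and>
        (\<forall>b \<in> B. g b = g' b) \<and> (\<forall>j \<in> J. g (a j) = g' (a' j))))"

type_synonym ('j, 's, 'u) gtype = "(('j \<Rightarrow> 'u) \<times> 'u set \<times> ('s, 'u) struct) set"

definition gtp ::
    "('s, 'u) abstract_class \<Rightarrow> 'j set \<Rightarrow> ('j \<Rightarrow> 'u) \<Rightarrow> 'u set \<Rightarrow> ('s, 'u) struct \<Rightarrow>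
       ('j, 's, 'u) gtype" where
  "gtp K J a B N = {x. (gtp_step K J)\<^sup>+\<^sup>+ (a, B, N) x}"

definition gS :: "('s, 'u) abstract_class \<Rightarrow> 'j set \<Rightarrow> ('s, 'u) struct \<Rightarrow> ('j, 's, 'u) gtype set" where
  "gS K J M = {gtp K J a (univ M) N | a N. le K M N \<and> a \<in> J \<rightarrow>\<^sub>E univ N}"

text \<open>Non-forking of a type over \<open>B\<close> is tested on some representative of the type.\<close>

definition nonforking ::
    "('s, 'u) abstract_class \<Rightarrow> ('s, 'u) square_pred \<Rightarrow> 'j set \<Rightarrow> 'u set \<Rightarrow>
       ('j, 's, 'u) gtype \<Rightarrow> ('s, 'u) struct \<Rightarrow> bool" where
  "nonforking K ind J B p N0 \<longleftrightarrow>
     (\<exists>a N3. N3 \<in> models K \<and> a \<in> J \<rightarrow>\<^sub>E univ N3 \<and> B \<subseteq> univ N3 \<and>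
        p = gtp K J a B N3 \<and> indep_sets K ind N0 (a ` J) B N3)"

definition right_local_character ::
    "('s, 'u) abstract_class \<Rightarrow> ('s, 'u) square_pred \<Rightarrow> bool" where
  "right_local_character K ind \<longleftrightarrow>
     (\<forall>\<alpha> :: 'u rel. is_cardinal \<alpha> \<longrightarrow>
        (\<exists>l :: 'u rel. is_cardinal l \<and>
           (\<forall>M \<in> models K. \<forall>p \<in> gS K (Field \<alpha>) M.
              \<exists>M0. le K M0 M \<and> |univ M0| \<le>o l \<and> nonforking K ind (Field \<alpha>) (univ M) p M0)))"

definition order_property_of_length ::
    "('s, 'u) abstract_class \<Rightarrow> 'u rel \<Rightarrow> 'u rel \<Rightarrow> bool" where
  "order_property_of_length K \<alpha> \<theta> \<longleftrightarrow>
     (\<exists>M \<in> models K. \<exists>a. (\<forall>i \<in> Field \<theta>. a i \<in> Field \<alpha> \<rightarrow>\<^sub>E univ M) \<and>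
        (\<forall>i0 j0 i1 j1. j0 \<in> Field \<theta> \<and> i0 \<in> underS \<theta> j0 \<and> j1 \<in> Field \<theta> \<and> i1 \<in> underS \<theta> j1 \<longrightarrow>
           gtp K (Field \<alpha> <+> Field \<alpha>) (case_sum (a i0) (a j0)) {} M \<noteq>
           gtp K (Field \<alpha> <+> Field \<alpha>) (case_sum (a j1) (a i1)) {} M))"

definition order_property :: "('s, 'u) abstract_class \<Rightarrow> bool" where
  "order_property K \<longleftrightarrow>
     (\<exists>\<alpha>. is_ordinal \<alpha> \<and> (\<forall>\<theta>. is_ordinal \<theta> \<longrightarrow> order_property_of_length K \<alpha> \<theta>))"

end

theory Submission
  imports Defs
begin

text \<open>
  Fix a sequence of tuples \<open>a\<^sub>j\<close> in a model such that \<open>a\<^sub>i a\<^sub>j\<close> and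
  \<open>a\<^sub>j a\<^sub>i\<close> have different types whenever \<open>i \<noteq> j\<close>; the order property
  provides such sequences of any length. Local character is refuted by a chain of models
  \<open>N\<^sub>i\<close> of length \<open>\<lambda>\<^sup>+\<close>, with union \<open>N\<close>, and one tuple
  \<open>d = a\<^sub>j\<close> that forks with \<open>N\<^sub>k\<close> over \<open>N\<^sub>i\<close> for all \<open>i < k\<close>:
  if \<open>d\<close> is independent from \<open>N\<close> over a model of size \<open>\<lambda>\<close>, then by
  regularity of \<open>\<lambda>\<^sup>+\<close> that model lies in some \<open>N\<^sub>i\<close>, and by base
  monotonicity \<open>d\<close> is independent from \<open>N\<close> over \<open>N\<^sub>i\<close>.

  Two consequences of uniqueness carry the construction of the next \<open>N\<^sub>i\<close>. The type over
  \<open>N\<close> of a pair \<open>(x, y)\<close> with \<open>x\<close> independent from \<open>y\<close> over \<open>N\<close>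
  is determined by the types of \<open>x\<close> and \<open>y\<close> over \<open>N\<close>
  (\<open>free_pair_type_unique\<close>). Together with local character this bounds the number of types
  over a model of size \<open>\<kappa> = 2\<^bsup>|X|\<^esup>\<close>, where \<open>|X| = 2\<^sup>\<lambda>\<close>, by
  \<open>\<kappa>\<close> (\<open>few_types\<close>). So at most \<open>\<kappa>\<close> of the \<open>a\<^sub>j\<close> represent
  all their types over \<open>N = N\<^sub>i\<close>. Let \<open>c\<close> be a representative, let \<open>d\<close>
  be another \<open>a\<^sub>j\<close> of the same type, and put \<open>c\<close> into the next model.

  If independence is symmetric and \<open>d\<close> were independent from \<open>c\<close> over \<open>N\<close>, then
  also \<open>c\<close> from \<open>d\<close>, and uniqueness makes the types of \<open>(d, c)\<close> and
  \<open>(c, d)\<close> equal, a contradiction (\<open>forking_step_symmetric\<close>). Without symmetry the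
  ambient model is enlarged by a copy \<open>e\<close> of \<open>c\<close> over \<open>N\<close> that is independent
  over \<open>N\<close> from the whole former ambient model, and \<open>e\<close> is put into the next model, too.
  If \<open>d\<close> were independent from the next model over \<open>N\<close>, then uniqueness would give
  \<open>(d, e) \<equiv> (d, c)\<close>, and \<open>(e, d) \<equiv> (d, c)\<close> as \<open>e\<close> is independent
  from \<open>d\<close>; hence \<open>(c, d) \<equiv> (e, d) \<equiv> (d, c)\<close>, the same contradiction
  (\<open>forking_step_extension\<close>). Here the ambient models grow, and chain bounds
  provide an ambient model at limit stages. No compatibility at limits is needed: below an upper
  bound of the ambient models, any small model that contains the earlier \<open>N\<^sub>i\<close> will do.

  Each of the \<open>\<lambda>\<^sup>+ \<le> \<kappa>\<close> stages spoils at most \<open>\<kappa>\<close> indices, so a sequence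
  longer than \<open>\<kappa>\<close> retains a suitable \<open>d\<close> at the end (\<open>no_large_asymmetric_family\<close>).
\<close>


section \<open>Transport of structure\<close>

definition img_struct ::
    "('s, 'u) abstract_class \<Rightarrow> ('u \<Rightarrow> 'u) \<Rightarrow> ('s, 'u) struct \<Rightarrow> ('s, 'u) struct" where
  "img_struct K g M =
     \<lparr>univ = g ` univ M,
      rel_in = (\<lambda>R \<in> rel_syms K. compose (arg_index K R) g ` rel_in M R),
      fun_in = (\<lambda>F \<in> fun_syms K. \<lambda>t \<in> tuples K F (g ` univ M).
        g (fun_in M F (compose (arg_index K F) (inv_into (univ M) g) t)))\<rparr>"

lemma tuples_mono: "A \<subseteq> B \<Longrightarrow> tuples K s A \<subseteq> tuples K s B"
  unfolding tuples_def by (rule PiE_mono) simp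

lemma compose_in_tuples:
  "t \<in> tuples K s A \<Longrightarrow> (\<And>x. x \<in> A \<Longrightarrow> g x \<in> B) \<Longrightarrow> compose (arg_index K s) g t \<in> tuples K s B"
  by (auto simp: tuples_def compose_def PiE_iff)

lemma compose_compose_tuple:
  "compose I g (compose I f t) = compose I (\<lambda>x. g (f x)) t"
  by (auto simp: compose_def fun_eq_iff restrict_def)

lemma compose_tuple_cong:
  "t \<in> tuples K s A \<Longrightarrow> (\<And>x. x \<in> A \<Longrightarrow> f x = g x) \<Longrightarrow>
     compose (arg_index K s) f t = compose (arg_index K s) g t"
  by (auto simp: compose_def tuples_def PiE_iff fun_eq_iff restrict_def)

lemma compose_tuple_id:
  "t \<in> tuples K s A \<Longrightarrow> (\<And>x. x \<in> A \<Longrightarrow> f x = x) \<Longrightarrow> compose (arg_index K s) f t = t"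
  by (auto simp: compose_def tuples_def PiE_iff fun_eq_iff restrict_def extensional_def)

lemma compose_tuple_inv:
  "t \<in> tuples K s A \<Longrightarrow> inj_on g A \<Longrightarrow>
     compose (arg_index K s) (inv_into A g) (compose (arg_index K s) g t) = t"
  by (simp add: compose_compose_tuple compose_tuple_id)

lemma struct_eqI:
  assumes "is_struct K M" "is_struct K N" "univ M = univ N"
    and "\<And>R. R \<in> rel_syms K \<Longrightarrow> rel_in M R = rel_in N R"
    and "\<And>F t. F \<in> fun_syms K \<Longrightarrow> t \<in> tuples K F (univ M) \<Longrightarrow> fun_in M F t = fun_in N F t"
  shows "M = N"
proof -
  have "rel_in M = rel_in N"
    using assms(1,2,4) unfolding is_struct_def by (auto intro!: extensionalityI[of _ "rel_syms K"] simp: PiE_iff)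
  moreover have "fun_in M = fun_in N"
  proof (rule extensionalityI[of _ "fun_syms K"])
    show "fun_in M \<in> extensional (fun_syms K)" "fun_in N \<in> extensional (fun_syms K)"
      using assms(1,2) by (auto simp: is_struct_def PiE_iff)
    fix F assume F: "F \<in> fun_syms K"
    show "fun_in M F = fun_in N F"
      apply (rule extensionalityI[of _ "tuples K F (univ M)"])
      using assms(1,2,3) F assms(5)[OF F] by (auto simp: is_struct_def PiE_iff)
  qed
  ultimately show ?thesis using assms(3) by (cases M, cases N) simp
qed

lemma rel_in_tuples: "is_struct K M \<Longrightarrow> R \<in> rel_syms K \<Longrightarrow> t \<in> rel_in M R \<Longrightarrow> t \<in> tuples K R (univ M)"
  by (auto simp: is_struct_def PiE_iff)

lemma fun_in_univ: "is_struct K M \<Longrightarrow> F \<in> fun_syms K \<Longrightarrow> t \<in> tuples K F (univ M) \<Longrightarrow> fun_in M F t \<in> univ M"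
  by (auto simp: is_struct_def PiE_iff)

lemma substruct_eq:
  assumes "substruct K M L" "substruct K N L" "univ M = univ N"
  shows "M = N"
  using assms by (intro struct_eqI[of K]) (auto simp: substruct_def)

lemma substruct_mid:
  assumes "substruct K M L" "substruct K N L" "univ M \<subseteq> univ N"
  shows "substruct K M N"
proof -
  have "t \<in> tuples K s (univ N)" if "t \<in> tuples K s (univ M)" for s t
    by (rule subsetD[OF tuples_mono[OF assms(3)] that])
  then have "X \<inter> tuples K s (univ M) = (X \<inter> tuples K s (univ N)) \<inter> tuples K s (univ M)" for X s by blast
  moreover note \<open>\<And>t s. t \<in> tuples K s (univ M) \<Longrightarrow> t \<in> tuples K s (univ N)\<close>
  ultimately show ?thesis using assms unfolding substruct_def by simp
qed

lemma is_iso_cong: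
  assumes "is_iso K f M N" "\<And>x. x \<in> univ M \<Longrightarrow> f x = g x"
  shows "is_iso K g M N"
proof -
  have 1: "compose (arg_index K s) f t = compose (arg_index K s) g t" if "t \<in> tuples K s (univ M)" for s t
    by (rule compose_tuple_cong[OF that]) (rule assms(2))
  have 2: "bij_betw g (univ M) (univ N)"
    using assms bij_betw_cong[of "univ M" f g "univ N"] by (auto simp: is_iso_def)
  show ?thesis
    using assms 2 by (auto simp: is_iso_def 1 fun_in_univ)
qed

lemma is_iso_comp:
  assumes f: "is_iso K f M N" and g: "is_iso K g N L"
  shows "is_iso K (\<lambda>x. g (f x)) M L"
proof -
  have b: "bij_betw (\<lambda>x. g (f x)) (univ M) (univ L)"
    using bij_betw_trans[of f "univ M" "univ N" g "univ L"] f g by (auto simp: is_iso_def comp_def)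
  have t: "compose (arg_index K s) f t \<in> tuples K s (univ N)" if "t \<in> tuples K s (univ M)" for s t
    by (rule compose_in_tuples[OF that]) (use f in \<open>auto simp: is_iso_def bij_betw_def\<close>)
  show ?thesis using f g b t
    by (auto simp: is_iso_def simp flip: compose_compose_tuple)
qed

lemma is_iso_inv:
  assumes f: "is_iso K f M N"
  shows "is_iso K (inv_into (univ M) f) N M"
proof -
  let ?g = "inv_into (univ M) f"
  have b: "bij_betw f (univ M) (univ N)" using f by (simp add: is_iso_def)
  have b': "bij_betw ?g (univ N) (univ M)" by (rule bij_betw_inv_into[OF b])
  have t: "compose (arg_index K s) ?g t \<in> tuples K s (univ M)" if "t \<in> tuples K s (univ N)" for s t
    by (rule compose_in_tuples[OF that]) (use b' in \<open>auto simp: bij_betw_def\<close>)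
  have tt: "compose (arg_index K s) f (compose (arg_index K s) ?g t) = t" if "t \<in> tuples K s (univ N)" for s t
    unfolding compose_compose_tuple
    by (rule compose_tuple_id[OF that]) (use b in \<open>auto simp: bij_betw_def f_inv_into_f\<close>)
  have MN: "is_struct K M" "is_struct K N" using f by (auto simp: is_iso_def)
  show ?thesis unfolding is_iso_def
  proof (intro conjI ballI MN b')
    fix R t assume R: "R \<in> rel_syms K" and tN: "t \<in> tuples K R (univ N)"
    show "t \<in> rel_in N R \<longleftrightarrow> compose (arg_index K R) ?g t \<in> rel_in M R"
      using f R t[OF tN] tt[OF tN] by (auto simp: is_iso_def)
  next
    fix F t assume F: "F \<in> fun_syms K" and tN: "t \<in> tuples K F (univ N)"
    have "f (fun_in M F (compose (arg_index K F) ?g t)) = fun_in N F t"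
      using f F t[OF tN] tt[OF tN] by (auto simp: is_iso_def)
    moreover have "fun_in M F (compose (arg_index K F) ?g t) \<in> univ M"
      by (rule fun_in_univ[OF MN(1) F t[OF tN]])
    ultimately show "?g (fun_in N F t) = fun_in M F (compose (arg_index K F) ?g t)"
      using b by (metis bij_betw_inv_into_left)
  qed
qed

lemma is_iso_img_struct:
  assumes M: "is_struct K M" and g: "inj_on g (univ M)"
  shows "is_iso K g M (img_struct K g M)"
proof -
  let ?I = "img_struct K g M"
  have inv: "inv_into (univ M) g y \<in> univ M" if "y \<in> g ` univ M" for y using that by (rule inv_into_into)
  have t1: "compose (arg_index K s) g t \<in> tuples K s (g ` univ M)" if "t \<in> tuples K s (univ M)" for s t
    by (rule compose_in_tuples[OF that]) auto
  have t2: "compose (arg_index K s) (inv_into (univ M) g) t \<in> tuples K s (univ M)"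
    if "t \<in> tuples K s (g ` univ M)" for s t
    by (rule compose_in_tuples[OF that]) (rule inv)
  have "small (g ` univ M)"
    using M ordLeq_ordLess_trans[OF card_of_image] unfolding is_struct_def small_def by blast
  moreover have "rel_in ?I \<in> (\<Pi>\<^sub>E R \<in> rel_syms K. Pow (tuples K R (univ ?I)))"
    using t1 rel_in_tuples[OF M] by (fastforce simp: img_struct_def)
  moreover have "fun_in ?I \<in> (\<Pi>\<^sub>E F \<in> fun_syms K. tuples K F (univ ?I) \<rightarrow>\<^sub>E univ ?I)"
    unfolding img_struct_def by (auto intro!: PiE_I imageI fun_in_univ[OF M] t2)
  ultimately have s: "is_struct K ?I" unfolding is_struct_def by (simp add: img_struct_def)
  have r: "t \<in> rel_in M R \<longleftrightarrow> compose (arg_index K R) g t \<in> rel_in ?I R"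
    if "R \<in> rel_syms K" "t \<in> tuples K R (univ M)" for R t
  proof -
    have "t \<in> rel_in M R" if "compose (arg_index K R) g t = compose (arg_index K R) g t'" "t' \<in> rel_in M R" for t'
    proof -
      have "t = t'"
        using compose_tuple_inv[OF \<open>t \<in> tuples K R (univ M)\<close> g] that(1)
          compose_tuple_inv[OF rel_in_tuples[OF M \<open>R \<in> rel_syms K\<close> that(2)] g] by (metis (no_types))
      with that(2) show ?thesis by (simp only:)
    qed
    then show ?thesis using that by (auto simp: img_struct_def)
  qed
  show ?thesis unfolding is_iso_def
    using M g s r t1 by (auto simp: bij_betw_def compose_tuple_inv img_struct_def)
qed

lemma substruct_iso:
  assumes N: "is_iso K f N N'" and M: "is_iso K f M M'" and MN: "substruct K M N"
  shows "substruct K M' N'"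
proof -
  let ?g = "inv_into (univ M) f"
  have iM: "is_iso K ?g M' M" by (rule is_iso_inv[OF M])
  have bM: "bij_betw f (univ M) (univ M')" and bN: "bij_betw f (univ N) (univ N')"
    using M N by (auto simp: is_iso_def)
  have sub: "univ M \<subseteq> univ N" using MN by (simp add: substruct_def)
  have sub': "univ M' \<subseteq> univ N'" using bM bN sub unfolding bij_betw_def by blast
  have t: "compose (arg_index K s) ?g t \<in> tuples K s (univ M)" if "t \<in> tuples K s (univ M')" for s t
    by (rule compose_in_tuples[OF that]) (use bM in \<open>auto simp: bij_betw_def inv_into_into\<close>)
  have tt: "compose (arg_index K s) f (compose (arg_index K s) ?g t) = t" if "t \<in> tuples K s (univ M')" for s t
    unfolding compose_compose_tuple
    by (rule compose_tuple_id[OF that]) (use bM in \<open>auto simp: bij_betw_def f_inv_into_f\<close>)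
  have tN: "compose (arg_index K s) ?g t \<in> tuples K s (univ N)" if "t \<in> tuples K s (univ M')" for s t
    by (rule subsetD[OF tuples_mono[OF sub] t[OF that]])
  have M's: "is_struct K M'" using M by (simp add: is_iso_def)
  have rM: "t \<in> rel_in M' R \<longleftrightarrow> t \<in> rel_in N' R" if "R \<in> rel_syms K" "t \<in> tuples K R (univ M')" for R t
    using that M N MN t[OF that(2)] tt[OF that(2)] tN[OF that(2)]
    unfolding is_iso_def substruct_def by (metis IntD1 IntI)
  have fM: "fun_in M' F t = fun_in N' F t" if "F \<in> fun_syms K" "t \<in> tuples K F (univ M')" for F t
    using that M N MN t[OF that(2)] tt[OF that(2)] tN[OF that(2)]
    unfolding is_iso_def substruct_def by metis
  show ?thesis unfolding substruct_def
    using M's N sub' rM fM rel_in_tuples[OF M's] unfolding is_iso_def by blast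
qed

lemma is_iso_unique:
  assumes "is_iso K f M N" "is_iso K f M N'"
  shows "N = N'"
proof -
  have "substruct K M M" using assms by (auto simp: is_iso_def substruct_def dest: rel_in_tuples)
  from substruct_iso[OF assms this] substruct_iso[OF assms(2,1) this] assms
  show ?thesis by (intro substruct_eq[of K N N' N']) (auto simp: substruct_def is_iso_def bij_betw_def dest: rel_in_tuples)
qed


section \<open>The category of embeddings\<close>

locale mu_AEC =
  fixes K :: "('s, 'u) abstract_class"
  assumes inaccessible: "inaccessible_universe TYPE('u)"
    and mu_AEC: "is_mu_AEC K"
begin

lemma infinite_universe: "\<not> finite (UNIV :: 'u set)"
  using inaccessible by (metis inaccessible_universe_def infinite_iff_natLeq_ordLeq ordLess_imp_ordLeq)

lemma le_partial_order: "partial_order_on (models K) {(M, N). le K M N}"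
  using mu_AEC unfolding is_mu_AEC_def is_abstract_class_def by (elim conjE)

lemma le_modelsD: "le K M N \<Longrightarrow> M \<in> models K" "le K M N \<Longrightarrow> N \<in> models K"
  using partial_order_onD(4)[OF le_partial_order] by auto

lemma le_refl: "M \<in> models K \<Longrightarrow> le K M M"
  using partial_order_onD(1)[OF le_partial_order] by (simp add: refl_on_def)

lemma le_trans: "le K M N \<Longrightarrow> le K N L \<Longrightarrow> le K M L"
  using partial_order_onD(2)[OF le_partial_order] unfolding trans_def by blast

lemma le_substruct: "le K M N \<Longrightarrow> substruct K M N"
  using mu_AEC unfolding is_mu_AEC_def is_abstract_class_def by blast

lemma le_univ: "le K M N \<Longrightarrow> univ M \<subseteq> univ N"
  using le_substruct by (auto simp: substruct_def)

lemma model_struct: "M \<in> models K \<Longrightarrow> is_struct K M"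
  using mu_AEC unfolding is_mu_AEC_def is_abstract_class_def by blast

lemma iso_model: "M \<in> models K \<Longrightarrow> is_iso K f M N \<Longrightarrow> N \<in> models K"
  using mu_AEC unfolding is_mu_AEC_def is_abstract_class_def by blast

lemma le_iso:
  assumes "le K M N" "is_iso K f N N'" "is_iso K f M M'"
  shows "le K M' N'"
  using mu_AEC assms substruct_iso[OF assms(2,3) le_substruct[OF assms(1)]]
  unfolding is_mu_AEC_def is_abstract_class_def by metis

lemma le_coherent:
  assumes "le K M L" "le K N L" "univ M \<subseteq> univ N"
  shows "le K M N"
  using mu_AEC assms substruct_mid[OF le_substruct[OF assms(1)] le_substruct[OF assms(2)] assms(3)]
    le_modelsD[OF assms(1)] le_modelsD[OF assms(2)]
  unfolding is_mu_AEC_def coherence_def by blast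

lemma le_eqI: "le K M L \<Longrightarrow> le K N L \<Longrightarrow> univ M = univ N \<Longrightarrow> M = N"
  using le_substruct substruct_eq by blast

lemma iso_id: "M \<in> models K \<Longrightarrow> is_iso K (\<lambda>x. x) M M"
  using model_struct by (auto simp: is_iso_def compose_tuple_id bij_betw_def)

lemma embedding_comp:
  assumes f: "is_embedding K f M N" and g: "is_embedding K g N L"
  shows "is_embedding K (compose (univ M) g f) M L"
proof -
  obtain M' where M': "le K M' N" "is_iso K f M M'" using f by (auto simp: is_embedding_def)
  obtain N' where N': "le K N' L" "is_iso K g N N'" using g by (auto simp: is_embedding_def)
  have "inj_on g (univ M')"
    using N'(2) le_univ[OF M'(1)] by (auto simp: is_iso_def bij_betw_def intro: inj_on_subset)
  then have i: "is_iso K g M' (img_struct K g M')"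
    by (intro is_iso_img_struct model_struct le_modelsD[OF M'(1)])
  have "le K (img_struct K g M') L"
    using le_trans[OF le_iso[OF M'(1) N'(2) i] N'(1)] .
  moreover have "is_iso K (compose (univ M) g f) M (img_struct K g M')"
    by (rule is_iso_cong[OF is_iso_comp[OF M'(2) i]]) (simp add: compose_def)
  ultimately show ?thesis using f g by (auto simp: is_embedding_def)
qed

abbreviation arr :: "('s, 'u) arrow \<Rightarrow> bool" where "arr \<equiv> is_arrow K"

lemma arr_map: "arr f \<Longrightarrow> x \<in> univ (src f) \<Longrightarrow> map_of_arrow f x \<in> univ (tgt f)"
  by (auto simp: is_arrow_def is_embedding_def is_iso_def bij_betw_def dest!: le_univ)

lemma arr_inj: "arr f \<Longrightarrow> inj_on (map_of_arrow f) (univ (src f))"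
  by (auto simp: is_arrow_def is_embedding_def is_iso_def bij_betw_def)

lemma arr_models: "arr f \<Longrightarrow> src f \<in> models K" "arr f \<Longrightarrow> tgt f \<in> models K"
  by (auto simp: is_arrow_def is_embedding_def)

lemma comp_src [simp]: "src (g \<cdot> f) = src f"
  and comp_tgt [simp]: "tgt (g \<cdot> f) = tgt g"
  by (auto simp: comp_arrow_def)

lemma comp_map [simp]: "x \<in> univ (src f) \<Longrightarrow> map_of_arrow (g \<cdot> f) x = map_of_arrow g (map_of_arrow f x)"
  by (auto simp: comp_arrow_def compose_def)

lemma arr_comp: "arr f \<Longrightarrow> arr g \<Longrightarrow> src g = tgt f \<Longrightarrow> arr (g \<cdot> f)"
  by (auto simp: is_arrow_def comp_arrow_def embedding_comp)

lemma comp_assoc: "arr f \<Longrightarrow> src g = tgt f \<Longrightarrow> (h \<cdot> g) \<cdot> f = h \<cdot> (g \<cdot> f)"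
  by (auto simp: comp_arrow_def compose_def fun_eq_iff restrict_def arr_map)

lemma incl_src [simp]: "src (incl_arrow M N) = M"
  and incl_tgt [simp]: "tgt (incl_arrow M N) = N"
  and incl_map [simp]: "x \<in> univ M \<Longrightarrow> map_of_arrow (incl_arrow M N) x = x"
  by (auto simp: incl_arrow_def)

lemma arr_eqI:
  assumes "arr f" "arr g" "src f = src g" "tgt f = tgt g"
    and "\<And>x. x \<in> univ (src f) \<Longrightarrow> map_of_arrow f x = map_of_arrow g x"
  shows "f = g"
proof -
  have "map_of_arrow f = map_of_arrow g"
    by (rule extensionalityI[of _ "univ (src f)"]) (use assms in \<open>auto simp: is_arrow_def is_embedding_def\<close>)
  with assms(3,4) show ?thesis by (cases f, cases g) simp
qed

lemma arr_incl: "le K M N \<Longrightarrow> arr (incl_arrow M N)"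
  unfolding is_arrow_def is_embedding_def
  using le_modelsD[of M N] is_iso_cong[OF iso_id[of M], of "map_of_arrow (incl_arrow M N)"]
  by (auto simp: incl_arrow_def)

lemma comp_incl: "le K M N \<Longrightarrow> le K N L \<Longrightarrow> incl_arrow N L \<cdot> incl_arrow M N = incl_arrow M L"
  by (rule arr_eqI) (auto simp: arr_comp arr_incl le_trans subsetD[OF le_univ[of M N]])

lemma id_comp: "arr f \<Longrightarrow> incl_arrow (tgt f) (tgt f) \<cdot> f = f"
  by (rule arr_eqI) (auto simp: arr_comp arr_incl le_refl arr_models arr_map)

lemma arr_id: "M \<in> models K \<Longrightarrow> arr (incl_arrow M M)"
  by (simp add: arr_incl le_refl)

lemma arr_of_embedding:
  "is_embedding K g M N \<Longrightarrow> arr \<lparr>src = M, tgt = N, map_of_arrow = g\<rparr>"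
  by (simp add: is_arrow_def)

text \<open>
  Equality of Galois types only says that two embeddings agree on the points of \<open>M\<close>. This
  suffices to see \<open>M\<close> as a strong submodel of the second source as well: the image of \<open>M\<close> is strong
  in the common target and contained in the image of the second source, so coherence applies.
\<close>

lemma le_of_agreeing_arrows:
  assumes g: "arr g" and g': "arr g'" and t: "tgt g = tgt g'"
    and M: "le K M (src g)" and sub: "univ M \<subseteq> univ (src g')"
    and eq: "\<And>x. x \<in> univ M \<Longrightarrow> map_of_arrow g x = map_of_arrow g' x"
  shows "le K M (src g')"
proof -
  let ?g = "map_of_arrow g" and ?g' = "map_of_arrow g'"
  obtain A where A: "le K A (tgt g)" "is_iso K ?g (src g) A"
    using g by (auto simp: is_arrow_def is_embedding_def)
  obtain B where B: "le K B (tgt g)" "is_iso K ?g' (src g') B"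
    using g' t by (auto simp: is_arrow_def is_embedding_def)
  let ?h = "inv_into (univ (src g')) ?g'"
  have i: "is_iso K ?g M (img_struct K ?g M)"
    using le_univ[OF M] arr_inj[OF g] by (intro is_iso_img_struct model_struct le_modelsD[OF M]) (auto intro: inj_on_subset)
  have "le K (img_struct K ?g M) (tgt g)"
    using le_trans[OF le_iso[OF M A(2) i] A(1)] .
  moreover have u: "univ (img_struct K ?g M) \<subseteq> univ B"
  proof -
    have "univ B = ?g' ` univ (src g')" using B(2) by (auto simp: is_iso_def bij_betw_def)
    then show ?thesis using sub eq by (auto simp: img_struct_def)
  qed
  ultimately have l: "le K (img_struct K ?g M) B" using le_coherent B(1) by blast
  have h: "is_iso K ?h B (src g')" by (rule is_iso_inv[OF B(2)])
  have "inj_on ?h (univ B)" using h by (auto simp: is_iso_def bij_betw_def)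
  then have i2: "is_iso K ?h (img_struct K ?g M) (img_struct K ?h (img_struct K ?g M))"
    using u by (intro is_iso_img_struct model_struct le_modelsD[OF l]) (auto intro: inj_on_subset)
  have "is_iso K (\<lambda>x. x) M (img_struct K ?h (img_struct K ?g M))"
    by (rule is_iso_cong[OF is_iso_comp[OF i i2]])
      (use eq sub arr_inj[OF g'] in \<open>auto simp: subset_iff\<close>)
  then have "M = img_struct K ?h (img_struct K ?g M)"
    using is_iso_unique[OF iso_id] le_modelsD[OF M] by blast
  then show ?thesis using le_iso[OF l h i2] by simp
qed

lemma fresh_copy:
  assumes "small A" "small B"
  obtains w :: "'u \<Rightarrow> 'u" where "inj_on w A" "w ` A \<inter> B = {}"
proof -
  have "\<not> |- B| <o |UNIV :: 'u set|"
  proof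
    assume "|- B| <o |UNIV :: 'u set|"
    then have "|B \<union> - B| <o |UNIV :: 'u set|"
      using assms infinite_universe by (intro card_of_Un_ordLess_infinite) (auto simp: small_def)
    then show False using ordLess_irreflexive by auto
  qed
  then have "|UNIV :: 'u set| \<le>o |- B|" using ordLess_or_ordLeq card_of_Well_order by blast
  then have "|A| \<le>o |- B|" using assms ordLess_ordLeq_trans ordLess_imp_ordLeq by (metis small_def)
  then obtain w where "inj_on w A" "w ` A \<subseteq> - B" using card_of_ordLeq by metis
  then show thesis using that by blast
qed

text \<open>
  Existence yields amalgams as arrows, whereas chains of models need inclusions. The target is
  replaced by a copy in which the image of the source is moved back to the source and all other
  points are moved to fresh ones; the universe is large enough for that.
\<close>

lemma arrow_as_inclusion:
  assumes u: "arr u"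
  obtains P z where "le K (src u) P" "arr z" "src z = tgt u" "tgt z = P" "z \<cdot> u = incl_arrow (src u) P"
proof -
  let ?u = "map_of_arrow u" and ?A = "univ (src u)" and ?T = "univ (tgt u)"
  have "small ?T" "small ?A" using arr_models[OF u] model_struct by (auto simp: is_struct_def)
  then obtain w0 where w0: "inj_on w0 ?T" "w0 ` ?T \<inter> ?A = {}" using fresh_copy by blast
  define w where "w x = (if x \<in> ?u ` ?A then inv_into ?A ?u x else w0 x)" for x
  have wu: "w (?u x) = x" if "x \<in> ?A" for x using that arr_inj[OF u] by (auto simp: w_def)
  have inj: "inj_on w ?T"
  proof (rule inj_onI)
    fix x y assume xy: "x \<in> ?T" "y \<in> ?T" "w x = w y"
    show "x = y"
    proof (cases "x \<in> ?u ` ?A"; cases "y \<in> ?u ` ?A")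
      assume "x \<in> ?u ` ?A" "y \<in> ?u ` ?A" then show ?thesis using xy wu by force
    next
      assume "x \<in> ?u ` ?A" "y \<notin> ?u ` ?A" then show ?thesis using xy wu w0(2) by (force simp: w_def)
    next
      assume "x \<notin> ?u ` ?A" "y \<in> ?u ` ?A" then show ?thesis using xy wu w0(2) by (force simp: w_def)
    next
      assume "x \<notin> ?u ` ?A" "y \<notin> ?u ` ?A" then show ?thesis using xy w0(1) by (auto simp: w_def inj_on_def)
    qed
  qed
  let ?P = "img_struct K w (tgt u)"
  have iso: "is_iso K w (tgt u) ?P" by (rule is_iso_img_struct[OF model_struct inj]) (rule arr_models[OF u])
  have P: "?P \<in> models K" using iso_model[OF _ iso] arr_models[OF u] by blast
  define z where "z = \<lparr>src = tgt u, tgt = ?P, map_of_arrow = restrict w ?T\<rparr>"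
  have z: "arr z"
    unfolding z_def is_arrow_def is_embedding_def
    using arr_models[OF u] P le_refl[OF P] is_iso_cong[OF iso, of "restrict w ?T"] by auto
  obtain A' where A': "le K A' (tgt u)" "is_iso K ?u (src u) A'"
    using u by (auto simp: is_arrow_def is_embedding_def)
  have "is_iso K (inv_into ?A ?u) A' (src u)" by (rule is_iso_inv[OF A'(2)])
  then have "is_iso K w A' (src u)"
    by (rule is_iso_cong) (use A'(2) in \<open>auto simp: w_def is_iso_def bij_betw_def\<close>)
  then have le: "le K (src u) ?P" using le_iso[OF A'(1) iso] by blast
  have "z \<cdot> u = incl_arrow (src u) ?P"
    by (rule arr_eqI) (use u z le arr_map[OF u] wu in \<open>auto simp: z_def arr_incl intro!: arr_comp\<close>)
  with that[OF le z] show thesis by (simp add: z_def)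
qed

end


section \<open>Calculus of independent squares\<close>

locale independence = mu_AEC K
  for K :: "('s, 'u) abstract_class" +
  fixes ind :: "('s, 'u) square_pred"
  assumes ind_rel: "independence_relation K ind"
    and ind_transitive: "transitive ind"
    and ind_existence: "has_existence K ind"
    and ind_uniqueness: "has_uniqueness K ind"
begin

lemma ind_is_amalgam: "ind f1 f2 g1 g2 \<Longrightarrow> is_amalgam K f1 f2 g1 g2"
  using ind_rel by (auto simp: independence_relation_def)

lemma indD:
  assumes "ind f1 f2 g1 g2"
  shows "arr f1" "arr f2" "arr g1" "arr g2" "src f2 = src f1" "src g1 = tgt f1" "src g2 = tgt f2"
    "tgt g2 = tgt g1" "g1 \<cdot> f1 = g2 \<cdot> f2"
  using ind_is_amalgam[OF assms] by (auto simp: is_amalgam_def is_span_def)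

lemma ind_exists:
  assumes "arr f1" "arr f2" "src f1 = src f2"
  obtains g1 g2 where "ind f1 f2 g1 g2"
  using assms ind_existence unfolding has_existence_def is_span_def by blast

lemma amalgamation:
  assumes "arr f1" "arr f2" "src f1 = src f2"
  obtains g1 g2 where "arr g1" "arr g2" "src g1 = tgt f1" "src g2 = tgt f2" "tgt g1 = tgt g2"
    "g1 \<cdot> f1 = g2 \<cdot> f2"
proof -
  obtain g1 g2 where "ind f1 f2 g1 g2" using ind_exists assms by blast
  from indD[OF this] show thesis by (intro that[of g1 g2]) auto
qed

text \<open>
  Two successive joint extensions are amalgamated over the target that they share. So
  \<open>\<sim>\<^sup>*\<close> is transitive, and uniqueness provides a joint extension at once.
\<close>

lemma sim_step_trans:
  assumes "sim_step K f1 f2 (a1, a2) (b1, b2)" "sim_step K f1 f2 (b1, b2) (c1, c2)"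
  shows "sim_step K f1 f2 (a1, a2) (c1, c2)"
proof -
  obtain ha hb where h: "arr ha" "arr hb" "src ha = tgt a1" "src hb = tgt b1" "tgt ha = tgt hb"
    "ha \<cdot> a1 = hb \<cdot> b1" "ha \<cdot> a2 = hb \<cdot> b2"
    using assms(1) by (auto simp: sim_step_def)
  obtain kb kc where k: "arr kb" "arr kc" "src kb = tgt b1" "src kc = tgt c1" "tgt kb = tgt kc"
    "kb \<cdot> b1 = kc \<cdot> c1" "kb \<cdot> b2 = kc \<cdot> c2"
    using assms(2) by (auto simp: sim_step_def)
  have am: "is_amalgam K f1 f2 a1 a2" "is_amalgam K f1 f2 b1 b2" "is_amalgam K f1 f2 c1 c2"
    using assms by (auto simp: sim_step_def)
  obtain p q where pq: "arr p" "arr q" "src p = tgt hb" "src q = tgt kb" "tgt p = tgt q" "p \<cdot> hb = q \<cdot> kb"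
    using amalgamation[OF h(2) k(1)] h k by metis
  have eq: "(p \<cdot> ha) \<cdot> x = (q \<cdot> kc) \<cdot> z"
    if "arr x" "arr y" "arr z" "tgt x = tgt a1" "tgt y = tgt b1" "tgt z = tgt c1"
      "ha \<cdot> x = hb \<cdot> y" "kb \<cdot> y = kc \<cdot> z" for x y z
  proof -
    have "(p \<cdot> ha) \<cdot> x = p \<cdot> (hb \<cdot> y)" using that h pq by (simp add: comp_assoc)
    also have "\<dots> = (q \<cdot> kb) \<cdot> y" using that h pq by (simp flip: pq(6) add: comp_assoc)
    also have "\<dots> = (q \<cdot> kc) \<cdot> z" using that k pq by (simp add: comp_assoc)
    finally show ?thesis .
  qed
  show ?thesis unfolding sim_step_def prod.case
  proof (intro conjI exI)
    show "arr (p \<cdot> ha)" "arr (q \<cdot> kc)" using h k pq by (auto intro!: arr_comp)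
    show "(p \<cdot> ha) \<cdot> a1 = (q \<cdot> kc) \<cdot> c1" "(p \<cdot> ha) \<cdot> a2 = (q \<cdot> kc) \<cdot> c2"
      using h k am by (auto simp: is_amalgam_def intro!: eq[of a1 b1 c1] eq[of a2 b2 c2])
  qed (use h k pq am in auto)
qed

lemma sim_imp_sim_step: "sim K f1 f2 x y \<Longrightarrow> sim_step K f1 f2 x y"
  unfolding sim_def
proof (induction rule: tranclp_induct)
  case (step y z)
  then show ?case
    using sim_step_trans[of f1 f2 "fst x" "snd x" "fst y" "snd y" "fst z" "snd z"] by simp
qed

lemma ind_sim_step: "ind f1 f2 g1 g2 \<Longrightarrow> sim_step K f1 f2 (g1, g2) (h1, h2) \<Longrightarrow> ind f1 f2 h1 h2"
  using ind_rel unfolding independence_relation_def sim_def by (meson tranclp.r_into_trancl)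

lemma ind_unique:
  assumes "ind f1 f2 g1 g2" "ind f1 f2 h1 h2"
  obtains p q where "arr p" "arr q" "src p = tgt g1" "src q = tgt h1" "tgt p = tgt q"
    "p \<cdot> g1 = q \<cdot> h1" "p \<cdot> g2 = q \<cdot> h2"
proof -
  have "sim K f1 f2 (g1, g2) (h1, h2)" using ind_uniqueness assms by (auto simp: has_uniqueness_def)
  from sim_imp_sim_step[OF this] show thesis using that by (auto simp: sim_step_def)
qed

lemma ind_enlarge:
  assumes i: "ind f1 f2 g1 g2" and h: "arr h" "src h = tgt g1"
  shows "ind f1 f2 (h \<cdot> g1) (h \<cdot> g2)"
proof -
  note D = indD[OF i]
  have h1: "arr (h \<cdot> g1)" "arr (h \<cdot> g2)" using D h by (auto intro!: arr_comp)
  have "(h \<cdot> g1) \<cdot> f1 = (h \<cdot> g2) \<cdot> f2" using D h by (simp add: comp_assoc)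
  then have am: "is_amalgam K f1 f2 (h \<cdot> g1) (h \<cdot> g2)"
    using D h1 by (auto simp: is_amalgam_def is_span_def)
  have "sim_step K f1 f2 (g1, g2) (h \<cdot> g1, h \<cdot> g2)"
    unfolding sim_step_def prod.case
  proof (intro conjI ind_is_amalgam[OF i] am, rule exI[of _ h], rule exI[of _ "incl_arrow (tgt h) (tgt h)"])
    show "arr h \<and> arr (incl_arrow (tgt h) (tgt h)) \<and> src h = tgt g1 \<and>
        src (incl_arrow (tgt h) (tgt h)) = tgt (h \<cdot> g1) \<and> tgt h = tgt (incl_arrow (tgt h) (tgt h)) \<and>
        h \<cdot> g1 = incl_arrow (tgt h) (tgt h) \<cdot> h \<cdot> g1 \<and> h \<cdot> g2 = incl_arrow (tgt h) (tgt h) \<cdot> h \<cdot> g2"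
      using h arr_models[OF h(1)] id_comp[OF h1(1)] id_comp[OF h1(2)] by (auto intro: arr_id)
  qed
  then show ?thesis by (rule ind_sim_step[OF i])
qed

lemma ind_right_trans:
  "ind f01 f02 f13 f23 \<Longrightarrow> ind f23 f24 f35 f45 \<Longrightarrow> ind f01 (f24 \<cdot> f02) (f35 \<cdot> f13) f45"
  using ind_transitive unfolding transitive_def right_transitive_def by blast

lemma ind_left_trans:
  "ind f02 f01 f23 f13 \<Longrightarrow> ind f24 f23 f45 f35 \<Longrightarrow> ind (f24 \<cdot> f02) f01 f45 (f35 \<cdot> f13)"
  using ind_transitive unfolding transitive_def left_transitive_def right_transitive_def dual_def by blast

text \<open>
  An independent square over \<open>f\<close> followed by \<open>k\<close> splits, after enlarging its target, into two
  independent squares: by transitivity, two successive independent amalgams form one independent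
  amalgam of the outer span, which by uniqueness agrees with the given one.
\<close>

lemma ind_split:
  assumes i: "ind f1 (k \<cdot> f) u1 u2" and f: "arr f" and k: "arr k" "src k = tgt f"
  obtains v1 v2 m z where "ind f1 f v1 v2" "ind v2 k m (z \<cdot> u2)" "m \<cdot> v1 = z \<cdot> u1"
    "arr z" "src z = tgt u1"
proof -
  note D = indD[OF i]
  obtain v1 v2 where v: "ind f1 f v1 v2" using ind_exists[of f1 f] D f by auto
  note V = indD[OF v]
  obtain w1 w2 where w: "ind v2 k w1 w2" using ind_exists[of v2 k] V k by auto
  note W = indD[OF w]
  obtain z y where z: "arr z" "arr y" "src z = tgt u1" "src y = tgt (w1 \<cdot> v1)" "tgt z = tgt y"
    "z \<cdot> u1 = y \<cdot> (w1 \<cdot> v1)" "z \<cdot> u2 = y \<cdot> w2"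
    using ind_unique[OF i ind_right_trans[OF v w]] by metis
  have "ind v2 k (y \<cdot> w1) (z \<cdot> u2)" using ind_enlarge[OF w z(2)] z by simp
  moreover have "(y \<cdot> w1) \<cdot> v1 = z \<cdot> u1" using z V W by (simp add: comp_assoc)
  ultimately show thesis using that v z by blast
qed


section \<open>Types and independence of tuples\<close>

text \<open>
  The type of \<open>a\<close> over the image of the arrow \<open>f\<close>. Taking an arrow as the base, not a
  set of parameters contained in both models, makes the notion invariant under isomorphisms on
  either side, so that amalgams need not be rewritten as inclusions.
\<close>

definition same_type ::
    "'j set \<Rightarrow> ('s, 'u) arrow \<Rightarrow> ('j \<Rightarrow> 'u) \<Rightarrow> ('s, 'u) arrow \<Rightarrow> ('j \<Rightarrow> 'u) \<Rightarrow> bool" where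
  "same_type J f a f' a' \<longleftrightarrow>
     arr f \<and> arr f' \<and> a \<in> J \<rightarrow> univ (tgt f) \<and> a' \<in> J \<rightarrow> univ (tgt f') \<and>
     (\<exists>g g'. arr g \<and> arr g' \<and> src g = tgt f \<and> src g' = tgt f' \<and> tgt g = tgt g' \<and>
        g \<cdot> f = g' \<cdot> f' \<and> (\<forall>j\<in>J. map_of_arrow g (a j) = map_of_arrow g' (a' j)))"

lemma same_typeI:
  assumes "arr f" "arr f'" "a \<in> J \<rightarrow> univ (tgt f)" "a' \<in> J \<rightarrow> univ (tgt f')"
    "arr g" "arr g'" "src g = tgt f" "src g' = tgt f'" "tgt g = tgt g'"
    "g \<cdot> f = g' \<cdot> f'" "\<And>j. j \<in> J \<Longrightarrow> map_of_arrow g (a j) = map_of_arrow g' (a' j)"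
  shows "same_type J f a f' a'"
  using assms unfolding same_type_def by blast

lemma same_typeE:
  assumes "same_type J f a f' a'"
  obtains g g' where "arr f" "arr f'" "a \<in> J \<rightarrow> univ (tgt f)" "a' \<in> J \<rightarrow> univ (tgt f')"
    "arr g" "arr g'" "src g = tgt f" "src g' = tgt f'" "tgt g = tgt g'"
    "g \<cdot> f = g' \<cdot> f'" "\<And>j. j \<in> J \<Longrightarrow> map_of_arrow g (a j) = map_of_arrow g' (a' j)"
  using assms unfolding same_type_def by blast

lemma same_type_sym: "same_type J f a f' a' \<Longrightarrow> same_type J f' a' f a"
  unfolding same_type_def by metis

lemma same_type_enlarge:
  assumes "arr f" "a \<in> J \<rightarrow> univ (tgt f)" "arr r" "src r = tgt f"
    "\<And>j. j \<in> J \<Longrightarrow> a' j = map_of_arrow r (a j)" "f' = r \<cdot> f"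
  shows "same_type J f a f' a'"
  by (rule same_typeI[of _ _ _ _ _ r "incl_arrow (tgt r) (tgt r)"])
    (use assms arr_models[OF assms(3)] id_comp[of "r \<cdot> f"] in
      \<open>auto simp: arr_comp arr_id arr_map Pi_iff\<close>)

lemma same_type_trans:
  assumes "same_type J f a f' a'" "same_type J f' a' f'' a''"
  shows "same_type J f a f'' a''"
proof -
  obtain g g' where g: "arr f" "arr f'" "a \<in> J \<rightarrow> univ (tgt f)" "a' \<in> J \<rightarrow> univ (tgt f')"
    "arr g" "arr g'" "src g = tgt f" "src g' = tgt f'" "tgt g = tgt g'"
    "g \<cdot> f = g' \<cdot> f'" "\<And>j. j \<in> J \<Longrightarrow> map_of_arrow g (a j) = map_of_arrow g' (a' j)"
    using same_typeE[OF assms(1)] by metis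
  obtain h h' where h: "arr f''" "a'' \<in> J \<rightarrow> univ (tgt f'')"
    "arr h" "arr h'" "src h = tgt f'" "src h' = tgt f''" "tgt h = tgt h'"
    "h \<cdot> f' = h' \<cdot> f''" "\<And>j. j \<in> J \<Longrightarrow> map_of_arrow h (a' j) = map_of_arrow h' (a'' j)"
    using same_typeE[OF assms(2)] by metis
  obtain p q where pq: "arr p" "arr q" "src p = tgt g'" "src q = tgt h" "tgt p = tgt q" "p \<cdot> g' = q \<cdot> h"
    using amalgamation[OF g(6) h(3)] g h by metis
  show ?thesis
  proof (rule same_typeI[of _ _ _ _ _ "p \<cdot> g" "q \<cdot> h'"])
    have "(p \<cdot> g) \<cdot> f = (p \<cdot> g') \<cdot> f'" using g pq(1-5) by (simp add: comp_assoc)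
    also have "\<dots> = q \<cdot> (h \<cdot> f')" using g h pq by (simp add: pq(6) comp_assoc)
    also have "\<dots> = (q \<cdot> h') \<cdot> f''" using g h pq by (simp add: comp_assoc)
    finally show "(p \<cdot> g) \<cdot> f = (q \<cdot> h') \<cdot> f''" .
    fix j assume j: "j \<in> J"
    have "map_of_arrow (p \<cdot> g) (a j) = map_of_arrow (p \<cdot> g') (a' j)" using j g pq(1-5) by (auto simp: Pi_iff)
    also have "\<dots> = map_of_arrow (q \<cdot> h') (a'' j)" using j g h pq by (simp add: Pi_iff)
    finally show "map_of_arrow (p \<cdot> g) (a j) = map_of_arrow (q \<cdot> h') (a'' j)" .
  qed (use g h pq in \<open>auto simp: arr_comp\<close>)
qed

text \<open>
  The tuple \<open>a\<close> in the target of \<open>h\<close> is independent from the image of \<open>h\<close> over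
  the image of \<open>h \<cdot> f\<close>: after enlarging the target along \<open>r\<close>, the tuple lies in one
  side of an independent square whose other side is \<open>h\<close>.
\<close>

definition free :: "'j set \<Rightarrow> ('s, 'u) arrow \<Rightarrow> ('s, 'u) arrow \<Rightarrow> ('j \<Rightarrow> 'u) \<Rightarrow> bool" where
  "free J f h a \<longleftrightarrow>
     arr h \<and> a \<in> J \<rightarrow> univ (tgt h) \<and>
     (\<exists>f1 u1 r x. ind f1 f u1 (r \<cdot> h) \<and> arr r \<and> src r = tgt h \<and> x \<in> J \<rightarrow> univ (tgt f1) \<and>
        (\<forall>j\<in>J. map_of_arrow r (a j) = map_of_arrow u1 (x j)))"

lemma freeI:
  assumes "arr h" "a \<in> J \<rightarrow> univ (tgt h)" "ind f1 f u1 (r \<cdot> h)" "arr r" "src r = tgt h"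
    "x \<in> J \<rightarrow> univ (tgt f1)" "\<And>j. j \<in> J \<Longrightarrow> map_of_arrow r (a j) = map_of_arrow u1 (x j)"
  shows "free J f h a"
  using assms unfolding free_def by blast

lemma freeE:
  assumes "free J f h a"
  obtains f1 u1 r x where "arr h" "a \<in> J \<rightarrow> univ (tgt h)" "ind f1 f u1 (r \<cdot> h)" "arr r" "src r = tgt h"
    "x \<in> J \<rightarrow> univ (tgt f1)" "\<And>j. j \<in> J \<Longrightarrow> map_of_arrow r (a j) = map_of_arrow u1 (x j)"
    "src h = tgt f" "tgt r = tgt u1" "arr f"
proof -
  obtain f1 u1 r x where *: "arr h" "a \<in> J \<rightarrow> univ (tgt h)" "ind f1 f u1 (r \<cdot> h)" "arr r" "src r = tgt h"
    "x \<in> J \<rightarrow> univ (tgt f1)" "\<And>j. j \<in> J \<Longrightarrow> map_of_arrow r (a j) = map_of_arrow u1 (x j)"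
    using assms unfolding free_def by blast
  show thesis by (rule that[OF *]) (use indD[OF *(3)] in auto)
qed

lemma freeD:
  assumes "free J f h a"
  shows "arr h" "arr f" "src h = tgt f" "a \<in> J \<rightarrow> univ (tgt h)"
  using assms by (auto elim: freeE)

text \<open>
  Monotonicity in the base and on the right come from the two squares of \<open>ind_split\<close>: the
  second one has the larger base, the first one the smaller right side.
\<close>

lemma free_base_mono:
  assumes "free J (k \<cdot> f) h a" "arr f" "arr k" "src k = tgt f"
  shows "free J k h a"
proof -
  obtain f1 u1 r x where F: "arr h" "a \<in> J \<rightarrow> univ (tgt h)" "ind f1 (k \<cdot> f) u1 (r \<cdot> h)" "arr r" "src r = tgt h"
    "x \<in> J \<rightarrow> univ (tgt f1)" "\<And>j. j \<in> J \<Longrightarrow> map_of_arrow r (a j) = map_of_arrow u1 (x j)"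
    "src h = tgt (k \<cdot> f)" "tgt r = tgt u1" "arr (k \<cdot> f)"
    using assms(1) by (rule freeE) blast
  obtain v1 v2 m z where v: "ind f1 f v1 v2" "ind v2 k m (z \<cdot> (r \<cdot> h))" "m \<cdot> v1 = z \<cdot> u1"
    "arr z" "src z = tgt u1"
    using ind_split[OF F(3) assms(2-4)] by metis
  note V = indD[OF v(1)] indD[OF v(2)]
  show ?thesis
  proof (rule freeI[of _ _ _ v2 _ m "z \<cdot> r" "\<lambda>j. map_of_arrow v1 (x j)"])
    show "ind v2 k m ((z \<cdot> r) \<cdot> h)" using v F by (simp add: comp_assoc)
    show "(\<lambda>j. map_of_arrow v1 (x j)) \<in> J \<rightarrow> univ (tgt v2)" using V F by (auto simp: arr_map Pi_iff)
    fix j assume j: "j \<in> J"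
    have xj: "x j \<in> univ (src v1)" using j F V by (auto simp: Pi_iff)
    have "map_of_arrow (z \<cdot> r) (a j) = map_of_arrow (z \<cdot> u1) (x j)"
      using j F V xj indD[OF F(3)] by (auto simp: Pi_iff)
    also have "\<dots> = map_of_arrow m (map_of_arrow v1 (x j))" using xj by (simp flip: v(3))
    finally show "map_of_arrow (z \<cdot> r) (a j) = map_of_arrow m (map_of_arrow v1 (x j))" .
  qed (use F v in \<open>auto simp: arr_comp\<close>)
qed

lemma free_mono:
  assumes "free J (k \<cdot> f) h a" "arr f" "arr k" "src k = tgt f"
  shows "free J f (h \<cdot> k) a"
proof -
  obtain f1 u1 r x where F: "arr h" "a \<in> J \<rightarrow> univ (tgt h)" "ind f1 (k \<cdot> f) u1 (r \<cdot> h)" "arr r" "src r = tgt h"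
    "x \<in> J \<rightarrow> univ (tgt f1)" "\<And>j. j \<in> J \<Longrightarrow> map_of_arrow r (a j) = map_of_arrow u1 (x j)"
    "src h = tgt (k \<cdot> f)" "tgt r = tgt u1" "arr (k \<cdot> f)"
    using assms(1) by (rule freeE) blast
  obtain v1 v2 m z where v: "ind f1 f v1 v2" "ind v2 k m (z \<cdot> (r \<cdot> h))" "m \<cdot> v1 = z \<cdot> u1"
    "arr z" "src z = tgt u1"
    using ind_split[OF F(3) assms(2-4)] by metis
  note V = indD[OF v(1)] indD[OF v(2)]
  show ?thesis
  proof (rule freeI[of _ _ _ f1 _ "m \<cdot> v1" "z \<cdot> r" x])
    have "m \<cdot> v2 = (z \<cdot> (r \<cdot> h)) \<cdot> k" using V by simp
    also have "\<dots> = (z \<cdot> r) \<cdot> (h \<cdot> k)" using assms F v by (simp add: comp_assoc arr_comp)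
    finally show "ind f1 f (m \<cdot> v1) ((z \<cdot> r) \<cdot> (h \<cdot> k))" using ind_enlarge[OF v(1), of m] V by simp
    fix j assume j: "j \<in> J"
    have xj: "x j \<in> univ (src u1)" using j F indD[OF F(3)] by (auto simp: Pi_iff)
    show "map_of_arrow (z \<cdot> r) (a j) = map_of_arrow (m \<cdot> v1) (x j)"
      using j F V xj by (simp add: v(3) Pi_iff)
  qed (use F v assms in \<open>auto simp: arr_comp\<close>)
qed

text \<open>
  Independent squares are closed under \<open>\<sim>\<close>, so the square that witnesses independence may
  be enlarged until it also contains the model in which the other tuple lives.
\<close>

lemma free_same_type:
  assumes "free J f h a" "same_type J h a h' a'"
  shows "free J f h' a'"
proof -
  obtain f1 u1 r x where F: "arr h" "a \<in> J \<rightarrow> univ (tgt h)" "ind f1 f u1 (r \<cdot> h)" "arr r" "src r = tgt h"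
    "x \<in> J \<rightarrow> univ (tgt f1)" "\<And>j. j \<in> J \<Longrightarrow> map_of_arrow r (a j) = map_of_arrow u1 (x j)"
    "src h = tgt f" "tgt r = tgt u1" "arr f"
    using assms(1) by (rule freeE) blast
  obtain g g' where g: "arr h'" "a' \<in> J \<rightarrow> univ (tgt h')"
    "arr g" "arr g'" "src g = tgt h" "src g' = tgt h'" "tgt g = tgt g'"
    "g \<cdot> h = g' \<cdot> h'" "\<And>j. j \<in> J \<Longrightarrow> map_of_arrow g (a j) = map_of_arrow g' (a' j)"
    using same_typeE[OF assms(2)] by metis
  obtain z w where z: "arr z" "arr w" "src z = tgt r" "src w = tgt g" "tgt z = tgt w" "z \<cdot> r = w \<cdot> g"
    using amalgamation[OF F(4) g(3)] F g by metis
  note D = indD[OF F(3)]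
  show ?thesis
  proof (rule freeI[of _ _ _ f1 _ "z \<cdot> u1" "w \<cdot> g'" x])
    have "z \<cdot> (r \<cdot> h) = (w \<cdot> g) \<cdot> h" using F z by (simp flip: comp_assoc)
    also have "\<dots> = (w \<cdot> g') \<cdot> h'" using F z g by (simp add: comp_assoc)
    finally show "ind f1 f (z \<cdot> u1) ((w \<cdot> g') \<cdot> h')" using ind_enlarge[OF F(3) z(1)] z F by simp
    fix j assume j: "j \<in> J"
    have xj: "x j \<in> univ (src u1)" using j F D by (auto simp: Pi_iff)
    have "map_of_arrow (w \<cdot> g') (a' j) = map_of_arrow (w \<cdot> g) (a j)" using j F g z by (simp add: Pi_iff)
    also have "\<dots> = map_of_arrow (z \<cdot> r) (a j)" using z by simp
    also have "\<dots> = map_of_arrow (z \<cdot> u1) (x j)" using j F xj by (simp add: Pi_iff)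
    finally show "map_of_arrow (w \<cdot> g') (a' j) = map_of_arrow (z \<cdot> u1) (x j)" .
  qed (use F g z in \<open>auto simp: arr_comp\<close>)
qed

text \<open>
  The two sides of a square are enlarged in turn, by left and by right transitivity. This brings
  squares with different sides over the same base onto a common span, where uniqueness applies.
\<close>

lemma ind_enlarge_sides:
  assumes i: "ind f1 f2 u1 u2" and g1: "arr g1" "src g1 = tgt f1" and g2: "arr g2" "src g2 = tgt f2"
  obtains v1 v2 r where "ind (g1 \<cdot> f1) (g2 \<cdot> f2) v1 v2" "arr r" "src r = tgt u1" "tgt r = tgt v1"
    "v1 \<cdot> g1 = r \<cdot> u1" "v2 \<cdot> g2 = r \<cdot> u2"
proof -
  note D = indD[OF i]
  obtain s t where s: "ind g1 u1 s t" using ind_exists[OF g1(1) D(3)] g1 D by auto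
  note S = indD[OF s]
  have 1: "ind (g1 \<cdot> f1) f2 s (t \<cdot> u2)" by (rule ind_left_trans[OF i s])
  obtain p q where p: "ind (t \<cdot> u2) g2 p q"
    using ind_exists[OF indD(4)[OF 1] g2(1)] g2 D by auto
  note P = indD[OF p]
  have 2: "ind (g1 \<cdot> f1) (g2 \<cdot> f2) (p \<cdot> s) q" by (rule ind_right_trans[OF 1 p])
  show thesis
  proof (rule that[OF 2, of "p \<cdot> t"])
    show "(p \<cdot> s) \<cdot> g1 = (p \<cdot> t) \<cdot> u1" using D S P g1 by (simp add: comp_assoc)
    show "q \<cdot> g2 = (p \<cdot> t) \<cdot> u2" using D S P g2 by (simp add: comp_assoc)
  qed (use D S P in \<open>auto intro!: arr_comp\<close>)
qed

text \<open>
  Stationarity. Equality of the two types on each side is witnessed by a common target; with both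
  sides enlarged to these targets the two independent squares have the same span, so by uniqueness
  they have a joint extension.
\<close>

lemma free_pair_type_unique:
  assumes a: "free J f h a" and a': "free J f' h' a'"
    and aa': "same_type J (h \<cdot> f) a (h' \<cdot> f') a'" and bb': "same_type I f b f' b'"
  shows "same_type (J <+> I) (h \<cdot> f) (case_sum a (\<lambda>i. map_of_arrow h (b i)))
           (h' \<cdot> f') (case_sum a' (\<lambda>i. map_of_arrow h' (b' i)))"
proof -
  obtain f1 u1 r x where F: "arr h" "a \<in> J \<rightarrow> univ (tgt h)" "ind f1 f u1 (r \<cdot> h)" "arr r" "src r = tgt h"
    "x \<in> J \<rightarrow> univ (tgt f1)" "\<And>j. j \<in> J \<Longrightarrow> map_of_arrow r (a j) = map_of_arrow u1 (x j)"
    "src h = tgt f" "tgt r = tgt u1" "arr f"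
    using a by (rule freeE) blast
  obtain f1' u1' r' x' where F': "arr h'" "a' \<in> J \<rightarrow> univ (tgt h')" "ind f1' f' u1' (r' \<cdot> h')" "arr r'" "src r' = tgt h'"
    "x' \<in> J \<rightarrow> univ (tgt f1')" "\<And>j. j \<in> J \<Longrightarrow> map_of_arrow r' (a' j) = map_of_arrow u1' (x' j)"
    "src h' = tgt f'" "tgt r' = tgt u1'" "arr f'"
    using a' by (rule freeE) blast
  note D = indD[OF F(3)] and D' = indD[OF F'(3)]
  have hf: "arr (h \<cdot> f)" "arr (h' \<cdot> f')" using F F' D D' by (auto intro: arr_comp)
  have "same_type J f1 x (u1 \<cdot> f1) (\<lambda>j. map_of_arrow u1 (x j))"
    by (rule same_type_enlarge) (use F D in auto)
  moreover have "same_type J (h \<cdot> f) a (u1 \<cdot> f1) (\<lambda>j. map_of_arrow u1 (x j))"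
    by (rule same_type_enlarge[of _ _ _ r]) (use F D hf in \<open>auto simp: comp_assoc\<close>)
  moreover have "same_type J f1' x' (u1' \<cdot> f1') (\<lambda>j. map_of_arrow u1' (x' j))"
    by (rule same_type_enlarge) (use F' D' in auto)
  moreover have "same_type J (h' \<cdot> f') a' (u1' \<cdot> f1') (\<lambda>j. map_of_arrow u1' (x' j))"
    by (rule same_type_enlarge[of _ _ _ r']) (use F' D' hf in \<open>auto simp: comp_assoc\<close>)
  ultimately have "same_type J f1 x f1' x'"
    using aa' by (meson same_type_sym same_type_trans)
  then obtain g1 g1' where g: "arr g1" "arr g1'" "src g1 = tgt f1" "src g1' = tgt f1'" "tgt g1 = tgt g1'"
    "g1 \<cdot> f1 = g1' \<cdot> f1'" "\<And>j. j \<in> J \<Longrightarrow> map_of_arrow g1 (x j) = map_of_arrow g1' (x' j)"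
    using same_typeE by metis
  obtain g2 g2' where k: "b \<in> I \<rightarrow> univ (tgt f)" "b' \<in> I \<rightarrow> univ (tgt f')"
    "arr g2" "arr g2'" "src g2 = tgt f" "src g2' = tgt f'" "tgt g2 = tgt g2'"
    "g2 \<cdot> f = g2' \<cdot> f'" "\<And>i. i \<in> I \<Longrightarrow> map_of_arrow g2 (b i) = map_of_arrow g2' (b' i)"
    using same_typeE[OF bb'] by metis
  obtain v1 v2 s where v: "ind (g1 \<cdot> f1) (g2 \<cdot> f) v1 v2" "arr s" "src s = tgt u1" "tgt s = tgt v1"
    "v1 \<cdot> g1 = s \<cdot> u1" "v2 \<cdot> g2 = s \<cdot> (r \<cdot> h)"
    using ind_enlarge_sides[OF F(3) g(1,3) k(3,5)] by metis
  obtain v1' v2' s' where v': "ind (g1' \<cdot> f1') (g2' \<cdot> f') v1' v2'" "arr s'" "src s' = tgt u1'" "tgt s' = tgt v1'"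
    "v1' \<cdot> g1' = s' \<cdot> u1'" "v2' \<cdot> g2' = s' \<cdot> (r' \<cdot> h')"
    using ind_enlarge_sides[OF F'(3) g(2,4) k(4,6)] by metis
  have "ind (g1 \<cdot> f1) (g2 \<cdot> f) v1' v2'" using v'(1) g(6) k(8) by simp
  then obtain p q where pq: "arr p" "arr q" "src p = tgt v1" "src q = tgt v1'" "tgt p = tgt q"
    "p \<cdot> v1 = q \<cdot> v1'" "p \<cdot> v2 = q \<cdot> v2'"
    using ind_unique[OF v(1)] by metis
  note V = indD[OF v(1)] and V' = indD[OF v'(1)]
  show ?thesis
  proof (rule same_typeI[of _ _ _ _ _ "p \<cdot> (s \<cdot> r)" "q \<cdot> (s' \<cdot> r')"])
    show "arr (h \<cdot> f)" "arr (h' \<cdot> f')" by fact+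
    show "arr (p \<cdot> s \<cdot> r)" "arr (q \<cdot> s' \<cdot> r')" using pq v v' F F' by (auto intro!: arr_comp)
    have "(p \<cdot> s \<cdot> r) \<cdot> h \<cdot> f = p \<cdot> (s \<cdot> r \<cdot> h) \<cdot> f"
      using pq v F D by (simp add: comp_assoc arr_comp)
    also have "\<dots> = (p \<cdot> v2) \<cdot> g2 \<cdot> f" using pq(1-5) k D V by (simp flip: v(6) add: comp_assoc arr_comp)
    also have "\<dots> = (q \<cdot> v2') \<cdot> g2' \<cdot> f'" using pq k by simp
    also have "\<dots> = q \<cdot> (s' \<cdot> r' \<cdot> h') \<cdot> f'" using pq(1-5) k D' V' by (simp flip: v'(6) add: comp_assoc arr_comp)
    also have "\<dots> = (q \<cdot> s' \<cdot> r') \<cdot> h' \<cdot> f'"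
      using pq v' F' D' by (simp add: comp_assoc arr_comp)
    finally show "(p \<cdot> s \<cdot> r) \<cdot> h \<cdot> f = (q \<cdot> s' \<cdot> r') \<cdot> h' \<cdot> f'" .
    show "case_sum a (\<lambda>i. map_of_arrow h (b i)) \<in> J <+> I \<rightarrow> univ (tgt (h \<cdot> f))"
      using F(2,8) k(1) arr_map[OF F(1)] by (auto simp: Pi_iff)
    show "case_sum a' (\<lambda>i. map_of_arrow h' (b' i)) \<in> J <+> I \<rightarrow> univ (tgt (h' \<cdot> f'))"
      using F'(2,8) k(2) arr_map[OF F'(1)] by (auto simp: Pi_iff)
    fix j assume "j \<in> J <+> I"
    then consider j0 where "j = Inl j0" "j0 \<in> J" | i where "j = Inr i" "i \<in> I" by auto
    then show "map_of_arrow (p \<cdot> s \<cdot> r) (case_sum a (\<lambda>i. map_of_arrow h (b i)) j) =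
        map_of_arrow (q \<cdot> s' \<cdot> r') (case_sum a' (\<lambda>i. map_of_arrow h' (b' i)) j)"
    proof cases
      case 1
      have x: "x j0 \<in> univ (src u1)" "x j0 \<in> univ (src g1)" "map_of_arrow g1 (x j0) \<in> univ (src v1)"
        "x' j0 \<in> univ (src u1')" "x' j0 \<in> univ (src g1')" "map_of_arrow g1' (x' j0) \<in> univ (src v1')"
        using funcset_mem[OF F(6) 1(2)] funcset_mem[OF F'(6) 1(2)] D(6) D'(6) g(3,4) V(6) V'(6)
          arr_map[OF g(1), of "x j0"] arr_map[OF g(2), of "x' j0"] by simp_all
      have "map_of_arrow (p \<cdot> s \<cdot> r) (a j0) = map_of_arrow p (map_of_arrow (s \<cdot> u1) (x j0))"
        using 1 F x by (simp add: Pi_iff)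
      also have "\<dots> = map_of_arrow (p \<cdot> v1) (map_of_arrow g1 (x j0))" using x by (simp flip: v(5))
      also have "\<dots> = map_of_arrow (q \<cdot> v1') (map_of_arrow g1' (x' j0))" using g(7) 1 pq by simp
      also have "\<dots> = map_of_arrow q (map_of_arrow (s' \<cdot> u1') (x' j0))" using x by (simp flip: v'(5))
      also have "\<dots> = map_of_arrow (q \<cdot> s' \<cdot> r') (a' j0)" using 1 F' x by (simp add: Pi_iff)
      finally show ?thesis using 1 by simp
    next
      case 2
      have x: "b i \<in> univ (src h)" "b i \<in> univ (src g2)" "map_of_arrow g2 (b i) \<in> univ (src v2)"
         "map_of_arrow h (b i) \<in> univ (src r)"
        "b' i \<in> univ (src h')" "b' i \<in> univ (src g2')" "map_of_arrow g2' (b' i) \<in> univ (src v2')"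
         "map_of_arrow h' (b' i) \<in> univ (src r')"
        using funcset_mem[OF k(1) 2(2)] funcset_mem[OF k(2) 2(2)] F(5,8) F'(5,8) k(5,6) V(7) V'(7)
          arr_map[OF k(3), of "b i"] arr_map[OF k(4), of "b' i"]
          arr_map[OF F(1), of "b i"] arr_map[OF F'(1), of "b' i"] by simp_all
      have "map_of_arrow (p \<cdot> s \<cdot> r) (map_of_arrow h (b i)) = map_of_arrow p (map_of_arrow (s \<cdot> r \<cdot> h) (b i))"
        using x by simp
      also have "\<dots> = map_of_arrow (p \<cdot> v2) (map_of_arrow g2 (b i))" using x by (simp flip: v(6))
      also have "\<dots> = map_of_arrow (q \<cdot> v2') (map_of_arrow g2' (b' i))" using k(9) 2 pq by simp
      also have "\<dots> = map_of_arrow q (map_of_arrow (s' \<cdot> r' \<cdot> h') (b' i))" using x by (simp flip: v'(6))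
      also have "\<dots> = map_of_arrow (q \<cdot> s' \<cdot> r') (map_of_arrow h' (b' i))" using x by simp
      finally show ?thesis using 2 by simp
    qed
  qed (simp_all add: F(5) F'(5) pq)
qed

end


section \<open>Cardinal arithmetic\<close>

lemma ordLeq_subset: "A \<subseteq> B \<Longrightarrow> |B| \<le>o r \<Longrightarrow> |A| \<le>o r"
  using card_of_mono1 ordLeq_transitive by blast

lemma ordLeq_image: "|A| \<le>o r \<Longrightarrow> |f ` A| \<le>o r"
  using card_of_image ordLeq_transitive by blast

lemma ordLeq_inj: "inj_on f A \<Longrightarrow> f ` A \<subseteq> B \<Longrightarrow> |B| \<le>o r \<Longrightarrow> |A| \<le>o r"
  using card_of_ordLeq[of A B] ordLeq_transitive[of "|A|" "|B|" r] by blast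

lemma ordLeq_Pow: "|A| \<le>o |B| \<Longrightarrow> |Pow A| \<le>o |Pow B|"
proof -
  assume "|A| \<le>o |B|"
  then obtain f where f: "inj_on f A" "f ` A \<subseteq> B" using card_of_ordLeq by metis
  show ?thesis
    by (rule ordLeq_inj[OF inj_on_image_Pow[OF f(1)] image_Pow_mono[OF f(2)]])
      (simp add: card_of_refl ordIso_imp_ordLeq)
qed

lemma ordLeq_Un: "\<not> finite B \<Longrightarrow> |A| \<le>o |B| \<Longrightarrow> |C| \<le>o |B| \<Longrightarrow> |A \<union> C| \<le>o |B|"
  by (rule card_of_Un_ordLeq_infinite_Field) (simp_all add: Field_card_of card_of_card_order_on)

lemma ordLeq_Times: "\<not> finite B \<Longrightarrow> |A| \<le>o |B| \<Longrightarrow> |C| \<le>o |B| \<Longrightarrow> |A \<times> C| \<le>o |B|"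
  by (rule card_of_Sigma_ordLeq_infinite) auto

lemma ordLeq_Pow_self: "|A| \<le>o |B| \<Longrightarrow> |A| \<le>o |Pow B|"
  using ordLeq_transitive[OF _ ordLess_imp_ordLeq[OF card_of_Pow]] by blast

lemma ordLeq_singleton: "\<not> finite B \<Longrightarrow> |{x}| \<le>o |B|"
  by (rule ordLess_imp_ordLeq, rule finite_ordLess_infinite) (auto simp: Field_card_of card_of_well_order_on)

text \<open>
  \<open>(2\<^sup>\<nu>)\<^sup>\<nu> = 2\<^sup>\<nu>\<close> is the reason for the choice of the sizes below as cardinals of
  power sets: a function from \<open>I\<close> into subsets of \<open>V\<close> is a subset of \<open>I \<times> V\<close>.
\<close>

lemma ordLeq_PiE:
  assumes V: "\<not> finite V" and I: "|I| \<le>o |V|" and A: "|A| \<le>o |Pow V|"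
  shows "|I \<rightarrow>\<^sub>E A| \<le>o |Pow V|"
proof -
  obtain g where g: "inj_on g A" "g ` A \<subseteq> Pow V" using A card_of_ordLeq by metis
  let ?F = "\<lambda>f. {(i, v). i \<in> I \<and> v \<in> g (f i)}"
  have "inj_on ?F (I \<rightarrow>\<^sub>E A)"
  proof (rule inj_onI)
    fix f f' assume f: "f \<in> I \<rightarrow>\<^sub>E A" "f' \<in> I \<rightarrow>\<^sub>E A" "?F f = ?F f'"
    show "f = f'"
    proof (rule PiE_ext[OF f(1,2)])
      fix i assume i: "i \<in> I"
      have "g (f i) = g (f' i)" using f(3) i by (auto simp: set_eq_iff)
      then show "f i = f' i" using g(1) f i by (auto simp: inj_on_def PiE_iff)
    qed
  qed
  moreover have "?F ` (I \<rightarrow>\<^sub>E A) \<subseteq> Pow (I \<times> V)" using g(2) by (force simp: PiE_iff)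
  moreover have "|Pow (I \<times> V)| \<le>o |Pow V|"
    by (intro ordLeq_Pow ordLeq_Times V I) (simp add: card_of_refl ordIso_imp_ordLeq)
  ultimately show ?thesis by (rule ordLeq_inj)
qed

lemma ordLeq_small_subsets:
  assumes V: "\<not> finite V" and Y: "|Y| \<le>o |V|" and A: "|A| \<le>o |Pow V|"
  shows "|{B. B \<subseteq> A \<and> |B| \<le>o |Y|}| \<le>o |Pow V|"
proof -
  have sub: "{B. B \<subseteq> A \<and> |B| \<le>o |Y|} \<subseteq> {{}} \<union> (\<lambda>f. f ` Y) ` (Y \<rightarrow>\<^sub>E A)"
  proof
    fix B assume B: "B \<in> {B. B \<subseteq> A \<and> |B| \<le>o |Y|}"
    show "B \<in> {{}} \<union> (\<lambda>f. f ` Y) ` (Y \<rightarrow>\<^sub>E A)"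
    proof (cases "B = {}")
      case False
      then obtain g where "g ` Y = B" using B card_of_ordLeq2[of B Y] by auto
      then have "restrict g Y \<in> Y \<rightarrow>\<^sub>E A" "B = restrict g Y ` Y" using B by auto
      then show ?thesis by blast
    qed simp
  qed
  have inf: "\<not> finite (Pow V)" using V by simp
  show ?thesis
    by (rule ordLeq_subset[OF sub])
      (intro ordLeq_Un inf ordLeq_singleton ordLeq_image ordLeq_PiE V Y A)
qed

lemma infinite_ordLeq: "\<not> finite A \<Longrightarrow> |A| \<le>o |B| \<Longrightarrow> \<not> finite B"
  using card_of_ordLeq_finite by blast

lemma representatives:
  assumes "|c ` S| \<le>o |B|"
  obtains E where "E \<subseteq> S" "|E| \<le>o |B|" "\<And>j. j \<in> S \<Longrightarrow> \<exists>i\<in>E. c i = c j"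
proof
  show "inv_into S c ` c ` S \<subseteq> S" by (auto intro: inv_into_into)
  show "|inv_into S c ` c ` S| \<le>o |B|" by (rule ordLeq_image[OF assms])
  show "\<exists>i\<in>inv_into S c ` c ` S. c i = c j" if "j \<in> S" for j using that by (auto simp: f_inv_into_f)
qed

lemma ordLeq_seqs_less:
  assumes V: "\<not> finite V" and m: "|Field m| \<le>o |V|" and A: "|A| \<le>o |Pow V|"
  shows "|seqs_less m A| \<le>o |Pow V|"
  unfolding seqs_less_def
proof (rule card_of_Sigma_ordLeq_infinite)
  show "\<not> finite (Pow V)" using V by simp
  show "|Field m| \<le>o |Pow V|" by (rule ordLeq_Pow_self[OF m])
  have "underS m x \<subseteq> Field m" for x by (auto simp: underS_def Field_def)
  then show "\<forall>x\<in>Field m. |underS m x \<rightarrow>\<^sub>E A| \<le>o |Pow V|"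
    by (intro ballI ordLeq_PiE V A ordLeq_subset[OF _ m])
qed


section \<open>Few types\<close>

context independence
begin

lemma same_type_cong:
  assumes "same_type J f a f' a'" "\<And>j. j \<in> J \<Longrightarrow> a j = b j" "\<And>j. j \<in> J \<Longrightarrow> a' j = b' j"
  shows "same_type J f b f' b'"
  using assms same_typeI[of f f' b J b'] by (elim same_typeE) (auto simp: Pi_iff)

lemma same_type_refl: "arr f \<Longrightarrow> a \<in> J \<rightarrow> univ (tgt f) \<Longrightarrow> same_type J f a f a"
  by (rule same_typeI[of _ _ _ _ _ "incl_arrow (tgt f) (tgt f)" "incl_arrow (tgt f) (tgt f)"])
    (auto simp: arr_id arr_models)

lemma same_type_incl:
  "le K N M \<Longrightarrow> le K M R \<Longrightarrow> a \<in> J \<rightarrow> univ M \<Longrightarrow> same_type J (incl_arrow N M) a (incl_arrow N R) a"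
  by (rule same_type_enlarge[of _ _ _ "incl_arrow M R"]) (auto simp: arr_incl comp_incl Pi_iff)

lemma same_type_in_extension:
  assumes "le K N M" "le K M R" "same_type J (incl_arrow N M) a (incl_arrow N M) a'"
  shows "same_type J (incl_arrow N R) a (incl_arrow N R) a'"
proof -
  have "a \<in> J \<rightarrow> univ M" "a' \<in> J \<rightarrow> univ M" using assms(3) by (auto simp: same_type_def)
  from same_type_incl[OF assms(1,2) this(1)] same_type_incl[OF assms(1,2) this(2)] show ?thesis
    by (rule same_type_trans[OF same_type_trans[OF same_type_sym assms(3)]])
qed

text \<open>
  Uniqueness of nonforking extensions: pair both tuples with an enumeration of the target of
  \<open>f\<close>, so that a joint extension which matches the pairs is one over the target of \<open>f\<close>.
\<close>

lemma free_type_unique: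
  assumes "free J f h a" "free J f h a'" "same_type J (h \<cdot> f) a (h \<cdot> f) a'"
  shows "same_type J h a h a'"
proof -
  let ?I = "univ (tgt f)"
  have h: "arr h" "src h = tgt f" "arr f" "a \<in> J \<rightarrow> univ (tgt h)" "a' \<in> J \<rightarrow> univ (tgt h)"
    using freeD[OF assms(1)] freeD[OF assms(2)] by auto
  have "same_type ?I f (\<lambda>x. x) f (\<lambda>x. x)" by (rule same_type_refl) (use h in auto)
  from free_pair_type_unique[OF assms this]
  obtain g g' where g: "arr g" "arr g'" "src g = tgt h" "src g' = tgt h" "tgt g = tgt g'"
    and eq: "\<And>j. j \<in> J <+> ?I \<Longrightarrow> map_of_arrow g (case_sum a (map_of_arrow h) j) =
        map_of_arrow g' (case_sum a' (map_of_arrow h) j)"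
    unfolding same_type_def comp_tgt by blast
  show ?thesis
  proof (rule same_typeI[OF h(1) h(1) h(4,5) g])
    show "g \<cdot> h = g' \<cdot> h"
      by (rule arr_eqI) (use g h eq[of "Inr _"] in \<open>auto intro!: arr_comp\<close>)
    show "map_of_arrow g (a j) = map_of_arrow g' (a' j)" if "j \<in> J" for j using eq[of "Inl j"] that by auto
  qed
qed

lemma gtp_step_iff:
  "gtp_step K J (a, B, N) (a', B', N') \<longleftrightarrow>
     N \<in> models K \<and> N' \<in> models K \<and> B' = B \<and> B \<subseteq> univ N \<and> B \<subseteq> univ N' \<and>
     a \<in> J \<rightarrow>\<^sub>E univ N \<and> a' \<in> J \<rightarrow>\<^sub>E univ N' \<and>
     (\<exists>g g'. arr g \<and> arr g' \<and> src g = N \<and> src g' = N' \<and> tgt g = tgt g' \<and>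
        (\<forall>b\<in>B. map_of_arrow g b = map_of_arrow g' b) \<and>
        (\<forall>j\<in>J. map_of_arrow g (a j) = map_of_arrow g' (a' j)))" (is "?L \<longleftrightarrow> ?R")
proof
  assume ?L
  then obtain Nbar g g' where *: "is_embedding K g N Nbar" "is_embedding K g' N' Nbar"
    "\<forall>b\<in>B. g b = g' b" "\<forall>j\<in>J. g (a j) = g' (a' j)"
    unfolding gtp_step_def by auto
  let ?g = "\<lparr>src = N, tgt = Nbar, map_of_arrow = g\<rparr>" and ?g' = "\<lparr>src = N', tgt = Nbar, map_of_arrow = g'\<rparr>"
  have "arr ?g" "arr ?g'" using * by (auto intro: arr_of_embedding)
  then have "\<exists>g g'. arr g \<and> arr g' \<and> src g = N \<and> src g' = N' \<and> tgt g = tgt g' \<and>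
        (\<forall>b\<in>B. map_of_arrow g b = map_of_arrow g' b) \<and>
        (\<forall>j\<in>J. map_of_arrow g (a j) = map_of_arrow g' (a' j))"
    using * by (intro exI[of _ ?g] exI[of _ ?g']) auto
  with \<open>?L\<close> show ?R unfolding gtp_step_def by auto
next
  assume ?R
  then show ?L unfolding gtp_step_def is_arrow_def by auto metis
qed

lemma gtp_step_trans:
  assumes "gtp_step K J x y" "gtp_step K J y z"
  shows "gtp_step K J x z"
proof -
  obtain a B N where x: "x = (a, B, N)" by (cases x)
  obtain a' B' N' where y: "y = (a', B', N')" by (cases y)
  obtain a'' B'' N'' where z: "z = (a'', B'', N'')" by (cases z)
  note 1 = assms(1)[unfolded x y gtp_step_iff] and 2 = assms(2)[unfolded y z gtp_step_iff]
  obtain g g' where g: "arr g" "arr g'" "src g = N" "src g' = N'" "tgt g = tgt g'"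
    "\<forall>b\<in>B. map_of_arrow g b = map_of_arrow g' b" "\<forall>j\<in>J. map_of_arrow g (a j) = map_of_arrow g' (a' j)"
    using 1 by blast
  obtain h h' where h: "arr h" "arr h'" "src h = N'" "src h' = N''" "tgt h = tgt h'"
    "\<forall>b\<in>B'. map_of_arrow h b = map_of_arrow h' b" "\<forall>j\<in>J. map_of_arrow h (a' j) = map_of_arrow h' (a'' j)"
    using 2 by blast
  have B: "B' = B" "B'' = B" "B \<subseteq> univ N" "B \<subseteq> univ N'" "B \<subseteq> univ N''" using 1 2 by auto
  have A: "a \<in> J \<rightarrow> univ N" "a' \<in> J \<rightarrow> univ N'" "a'' \<in> J \<rightarrow> univ N''" using 1 2 by auto
  obtain p q where pq: "arr p" "arr q" "src p = tgt g'" "src q = tgt h" "tgt p = tgt q" "p \<cdot> g' = q \<cdot> h"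
    using amalgamation[OF g(2) h(1)] g h by metis
  have eq: "map_of_arrow p (map_of_arrow g' y) = map_of_arrow q (map_of_arrow h y)" if "y \<in> univ N'" for y
    using arg_cong[OF pq(6), of "\<lambda>f. map_of_arrow f y"] that g h by simp
  have "\<exists>g g'. arr g \<and> arr g' \<and> src g = N \<and> src g' = N'' \<and> tgt g = tgt g' \<and>
        (\<forall>b\<in>B. map_of_arrow g b = map_of_arrow g' b) \<and>
        (\<forall>j\<in>J. map_of_arrow g (a j) = map_of_arrow g' (a'' j))"
  proof (rule exI[of _ "p \<cdot> g"], rule exI[of _ "q \<cdot> h'"], intro conjI ballI)
    show "arr (p \<cdot> g)" "arr (q \<cdot> h')" using g h pq by (auto intro!: arr_comp)
    show "map_of_arrow (p \<cdot> g) b = map_of_arrow (q \<cdot> h') b" if "b \<in> B" for b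
      using that B g h eq[of b] by (simp add: subset_iff)
    show "map_of_arrow (p \<cdot> g) (a j) = map_of_arrow (q \<cdot> h') (a'' j)" if "j \<in> J" for j
      using that A g h eq[of "a' j"] by (simp add: Pi_iff)
  qed (use g h pq in auto)
  with 1 2 show ?thesis unfolding x z gtp_step_iff by blast
qed

lemma gtp_step_refl: "N \<in> models K \<Longrightarrow> B \<subseteq> univ N \<Longrightarrow> a \<in> J \<rightarrow>\<^sub>E univ N \<Longrightarrow> gtp_step K J (a, B, N) (a, B, N)"
  unfolding gtp_step_iff using arr_id by (metis incl_src)

lemma gtp_step_sym: "gtp_step K J (a, B, N) (a', B', N') \<Longrightarrow> gtp_step K J (a', B', N') (a, B, N)"
  unfolding gtp_step_iff by metis

text \<open>
  Under amalgamation the generating relation of Galois types is already an equivalence, so equal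
  types are realized by equal tuples in one common extension.
\<close>

lemma gtp_eq_iff:
  assumes "N \<in> models K" "a \<in> J \<rightarrow>\<^sub>E univ N" "B \<subseteq> univ N"
  shows "gtp K J a' B N' = gtp K J a B N \<longleftrightarrow> gtp_step K J (a', B, N') (a, B, N)"
proof -
  have "(gtp_step K J)\<^sup>+\<^sup>+ x y \<Longrightarrow> gtp_step K J x y" for x y
    by (induction rule: tranclp_induct) (auto intro: gtp_step_trans)
  then have tr: "(gtp_step K J)\<^sup>+\<^sup>+ x y \<longleftrightarrow> gtp_step K J x y" for x y by blast
  have r: "gtp_step K J (a, B, N) (a, B, N)" by (rule gtp_step_refl) (use assms in auto)
  show ?thesis
  proof
    assume "gtp K J a' B N' = gtp K J a B N"
    then show "gtp_step K J (a', B, N') (a, B, N)" using r by (auto simp: gtp_def tr)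
  next
    assume s: "gtp_step K J (a', B, N') (a, B, N)"
    show "gtp K J a' B N' = gtp K J a B N"
      unfolding gtp_def tr using s gtp_step_sym[OF s] gtp_step_trans by blast
  qed
qed

end

text \<open>
  The parameters: \<open>\<mu>\<close>, the vocabulary, the tuples indexed by \<open>J\<close>, and the models
  provided by the Loewenheim-Skolem-Tarski axiom and by local character are all controlled by
  \<open>|Y|\<close>. Models of size at most \<open>|X| = 2\<^bsup>|Y|\<^esup>\<close> have at most
  \<open>2\<^bsup>|X|\<^esup>\<close> isomorphism types.
\<close>

locale bounded_independence = independence K ind
  for K :: "('s, 'u) abstract_class" and ind +
  fixes J Y X :: "'u set"
  assumes Y_infinite: "\<not> finite Y"
    and mu_bound: "|Field (mu K)| \<le>o |Y|"
    and vocabulary_bound: "|rel_syms K \<union> fun_syms K| \<le>o |Y|"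
    and J_bound: "|J| \<le>o |Y|"
    and LST: "\<And>M A. M \<in> models K \<Longrightarrow> A \<subseteq> univ M \<Longrightarrow>
      \<exists>M0. le K M0 M \<and> A \<subseteq> univ M0 \<and> |univ M0| \<le>o |seqs_less (mu K) A| +c |Y|"
    and local_character: "\<And>M p. M \<in> models K \<Longrightarrow> p \<in> gS K J M \<Longrightarrow>
      \<exists>M0. le K M0 M \<and> |univ M0| \<le>o |Y| \<and> nonforking K ind J (univ M) p M0"
    and X_Pow: "|X| =o |Pow Y|"
begin

lemma Y_le_X: "|Y| \<le>o |X|"
  using ordLeq_ordIso_trans[OF ordLess_imp_ordLeq[OF card_of_Pow] ordIso_symmetric[OF X_Pow]] .

lemma X_infinite: "\<not> finite X"
  using infinite_ordLeq[OF Y_infinite Y_le_X] .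

lemma PowX_infinite: "\<not> finite (Pow X)"
  using X_infinite by simp

lemma X_le_PowX: "|X| \<le>o |Pow X|"
  by (rule ordLess_imp_ordLeq[OF card_of_Pow])

lemma LST_Pow:
  assumes V: "|Y| \<le>o |V|" and M: "M \<in> models K" and A: "A \<subseteq> univ M" "|A| \<le>o |Pow V|"
  shows "\<exists>M0. le K M0 M \<and> A \<subseteq> univ M0 \<and> |univ M0| \<le>o |Pow V|"
proof -
  have inf: "\<not> finite V" using infinite_ordLeq[OF Y_infinite V] .
  obtain M0 where M0: "le K M0 M" "A \<subseteq> univ M0" "|univ M0| \<le>o |seqs_less (mu K) A| +c |Y|"
    using LST[OF M A(1)] by blast
  have "|seqs_less (mu K) A| +c |Y| \<le>o |Pow V|"
  proof (rule csum_cinfinite_bound)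
    show "|seqs_less (mu K) A| \<le>o |Pow V|"
      by (rule ordLeq_seqs_less[OF inf ordLeq_transitive[OF mu_bound V] A(2)])
    show "|Y| \<le>o |Pow V|" by (rule ordLeq_Pow_self[OF V])
  qed (simp_all add: card_of_card_order_on cinfinite_def inf Field_card_of)
  with M0 show ?thesis using ordLeq_transitive by blast
qed

lemma LST_X:
  assumes "M \<in> models K" "A \<subseteq> univ M" "|A| \<le>o |X|"
  shows "\<exists>M0. le K M0 M \<and> A \<subseteq> univ M0 \<and> |univ M0| \<le>o |X|"
  using LST_Pow[of Y M A] assms X_Pow
  by (metis card_of_refl ordIso_iff_ordLeq ordLeq_ordIso_trans ordIso_symmetric)

lemma LST_PowX:
  assumes "M \<in> models K" "A \<subseteq> univ M" "|A| \<le>o |Pow X|"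
  shows "\<exists>M0. le K M0 M \<and> A \<subseteq> univ M0 \<and> |univ M0| \<le>o |Pow X|"
  using LST_Pow[OF Y_le_X assms] .

lemma few_structures: "|{S. is_struct K S \<and> univ S \<subseteq> X}| \<le>o |Pow X|"
proof -
  define T where "T = (\<Union>x \<in> Field (mu K). underS (mu K) x \<rightarrow>\<^sub>E X)"
  have T: "|T| \<le>o |X|" unfolding T_def
  proof (rule card_of_UNION_ordLeq_infinite[OF X_infinite])
    show "|Field (mu K)| \<le>o |X|" by (rule ordLeq_transitive[OF mu_bound Y_le_X])
    have "underS (mu K) x \<subseteq> Field (mu K)" for x by (auto simp: underS_def Field_def)
    then have "|underS (mu K) x \<rightarrow>\<^sub>E X| \<le>o |Pow Y|" for x
      by (intro ordLeq_PiE Y_infinite ordLeq_subset[OF _ mu_bound] ordIso_imp_ordLeq X_Pow)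
    then show "\<forall>x\<in>Field (mu K). |underS (mu K) x \<rightarrow>\<^sub>E X| \<le>o |X|"
      using ordLeq_ordIso_trans ordIso_symmetric[OF X_Pow] by blast
  qed
  have tup: "tuples K s A \<subseteq> T" if "s \<in> rel_syms K \<union> fun_syms K" "A \<subseteq> X" for s A
  proof -
    have "is_vocabulary K" using mu_AEC unfolding is_mu_AEC_def is_abstract_class_def by (elim conjE)
    then have "arity K s \<in> Field (mu K)" using that unfolding is_vocabulary_def by blast
    then show ?thesis using tuples_mono[OF that(2), of K s] by (auto simp: T_def tuples_def arg_index_def)
  qed
  have voc: "|rel_syms K| \<le>o |X|" "|fun_syms K| \<le>o |X|"
    using ordLeq_transitive[OF vocabulary_bound Y_le_X] by (auto intro: ordLeq_subset)
  let ?C = "\<lambda>S. (univ S, {(R, t). R \<in> rel_syms K \<and> t \<in> rel_in S R},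
    {(F, t, y). F \<in> fun_syms K \<and> t \<in> tuples K F (univ S) \<and> y = fun_in S F t})"
  show ?thesis
  proof (rule ordLeq_inj[of ?C])
    show "inj_on ?C {S. is_struct K S \<and> univ S \<subseteq> X}"
    proof (rule inj_onI)
      fix S S' assume S: "S \<in> {S. is_struct K S \<and> univ S \<subseteq> X}" "S' \<in> {S. is_struct K S \<and> univ S \<subseteq> X}"
        and eq: "?C S = ?C S'"
      then have u: "univ S = univ S'" by simp
      show "S = S'"
      proof (rule struct_eqI[of K])
        show "is_struct K S" "is_struct K S'" using S by auto
        show "rel_in S R = rel_in S' R" if "R \<in> rel_syms K" for R
          using eq that by (auto simp: set_eq_iff)
        show "fun_in S F t = fun_in S' F t" if "F \<in> fun_syms K" "t \<in> tuples K F (univ S)" for F t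
        proof -
          have "{(F, t, y). F \<in> fun_syms K \<and> t \<in> tuples K F (univ S) \<and> y = fun_in S F t} =
              {(F, t, y). F \<in> fun_syms K \<and> t \<in> tuples K F (univ S') \<and> y = fun_in S' F t}"
            using eq unfolding prod.inject by (elim conjE)
          moreover have "(F, t, fun_in S F t) \<in>
              {(F, t, y). F \<in> fun_syms K \<and> t \<in> tuples K F (univ S) \<and> y = fun_in S F t}"
            using that by simp
          ultimately have "(F, t, fun_in S F t) \<in>
              {(F, t, y). F \<in> fun_syms K \<and> t \<in> tuples K F (univ S') \<and> y = fun_in S' F t}"
            by (simp only:)
          then show ?thesis by simp
        qed
      qed (rule u)
    qed
    show "?C ` {S. is_struct K S \<and> univ S \<subseteq> X} \<subseteq>
        Pow X \<times> Pow (rel_syms K \<times> T) \<times> Pow (fun_syms K \<times> T \<times> X)"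
    proof (rule image_subsetI)
      fix S assume "S \<in> {S. is_struct K S \<and> univ S \<subseteq> X}"
      then have S: "is_struct K S" "univ S \<subseteq> X" by auto
      have "t \<in> T" if "R \<in> rel_syms K" "t \<in> rel_in S R" for R t
        using tup[OF _ S(2), of R] rel_in_tuples[OF S(1) that] that by blast
      moreover have "t \<in> T \<and> fun_in S F t \<in> X" if "F \<in> fun_syms K" "t \<in> tuples K F (univ S)" for F t
        using tup[OF _ S(2), of F] fun_in_univ[OF S(1) that] that S(2) by blast
      ultimately show "?C S \<in> Pow X \<times> Pow (rel_syms K \<times> T) \<times> Pow (fun_syms K \<times> T \<times> X)"
        using S(2) by auto
    qed
    show "|Pow X \<times> Pow (rel_syms K \<times> T) \<times> Pow (fun_syms K \<times> T \<times> X)| \<le>o |Pow X|"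
      by (intro ordLeq_Times PowX_infinite ordLeq_Pow X_infinite voc T)
        (simp_all add: card_of_refl ordIso_imp_ordLeq)
  qed
qed

text \<open>
  Two tuples have the same type over \<open>M0\<close> as soon as they lie in small models that are
  isomorphic over \<open>M0\<close> by a map matching the tuples; copies on subsets of \<open>X\<close> bound
  the number of possibilities.
\<close>

lemma few_types_over_small_model:
  fixes a :: "'i \<Rightarrow> 'u \<Rightarrow> 'u"
  assumes M0: "le K M0 P" "|univ M0| \<le>o |X|" and a: "\<And>j. j \<in> S \<Longrightarrow> a j \<in> J \<rightarrow> univ P"
  shows "\<exists>c :: 'i \<Rightarrow> ('s, 'u) struct \<times> ('u \<Rightarrow> 'u) \<times> ('u \<Rightarrow> 'u). |c ` S| \<le>o |Pow X| \<and>
    (\<forall>i\<in>S. \<forall>j\<in>S. c i = c j \<longrightarrow> same_type J (incl_arrow M0 P) (a i) (incl_arrow M0 P) (a j))"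
proof -
  have J: "|J| \<le>o |X|" by (rule ordLeq_transitive[OF J_bound Y_le_X])
  have "\<exists>M. le K M P \<and> univ M0 \<union> a j ` J \<subseteq> univ M \<and> |univ M| \<le>o |X|" if "j \<in> S" for j
    using le_univ[OF M0(1)] a[OF that]
    by (intro LST_X le_modelsD(2)[OF M0(1)] ordLeq_Un X_infinite M0(2) ordLeq_image J) auto
  then obtain M where M: "\<And>j. j \<in> S \<Longrightarrow> le K (M j) P" "\<And>j. j \<in> S \<Longrightarrow> univ M0 \<subseteq> univ (M j)"
    "\<And>j. j \<in> S \<Longrightarrow> a j ` J \<subseteq> univ (M j)" "\<And>j. j \<in> S \<Longrightarrow> |univ (M j)| \<le>o |X|"
    by (metis le_sup_iff)
  have "\<exists>h. inj_on h (univ (M j)) \<and> h ` univ (M j) \<subseteq> X" if "j \<in> S" for j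
    using M(4)[OF that] card_of_ordLeq by blast
  then obtain h where h: "\<And>j. j \<in> S \<Longrightarrow> inj_on (h j) (univ (M j))" "\<And>j. j \<in> S \<Longrightarrow> h j ` univ (M j) \<subseteq> X"
    by metis
  have str: "is_struct K (M j)" if "j \<in> S" for j using model_struct le_modelsD(1)[OF M(1)[OF that]] .
  define c where "c j = (img_struct K (h j) (M j), restrict (h j) (univ M0), restrict (\<lambda>x. h j (a j x)) J)" for j
  have "|c ` S| \<le>o |Pow X|"
  proof (rule ordLeq_subset)
    show "c ` S \<subseteq> {S. is_struct K S \<and> univ S \<subseteq> X} \<times> (univ M0 \<rightarrow>\<^sub>E X) \<times> (J \<rightarrow>\<^sub>E X)"
    proof (rule image_subsetI)
      fix j assume j: "j \<in> S"
      have "is_struct K (img_struct K (h j) (M j))"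
        using is_iso_img_struct[OF str h(1)] j by (auto simp: is_iso_def)
      then show "c j \<in> {S. is_struct K S \<and> univ S \<subseteq> X} \<times> (univ M0 \<rightarrow>\<^sub>E X) \<times> (J \<rightarrow>\<^sub>E X)"
        using h(2)[OF j] M(2,3)[OF j] by (fastforce simp: c_def img_struct_def)
    qed
    show "|{S. is_struct K S \<and> univ S \<subseteq> X} \<times> (univ M0 \<rightarrow>\<^sub>E X) \<times> (J \<rightarrow>\<^sub>E X)| \<le>o |Pow X|"
      by (intro ordLeq_Times PowX_infinite few_structures ordLeq_PiE X_infinite M0 X_le_PowX J)
  qed
  moreover have "same_type J (incl_arrow M0 P) (a i) (incl_arrow M0 P) (a j)"
    if i: "i \<in> S" and j: "j \<in> S" and eq: "c i = c j" for i j
  proof -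
    let ?h' = "inv_into (univ (M j)) (h j)"
    let ?f = "\<lambda>x. ?h' (h i x)"
    have "is_iso K ?h' (img_struct K (h i) (M i)) (M j)"
      using is_iso_inv[OF is_iso_img_struct[OF str h(1)]] j eq by (auto simp: c_def)
    then have iso: "is_iso K ?f (M i) (M j)"
      using is_iso_comp[OF is_iso_img_struct[OF str h(1)]] i by blast
    define z where "z = \<lparr>src = M i, tgt = M j, map_of_arrow = restrict ?f (univ (M i))\<rparr>"
    have z: "arr z" unfolding z_def is_arrow_def is_embedding_def
      using le_modelsD(1)[OF M(1)] i j le_refl is_iso_cong[OF iso, of "restrict ?f (univ (M i))"] by auto
    have le0: "le K M0 (M i)" "le K M0 (M j)" using le_coherent[OF M0(1) M(1) M(2)] i j by auto
    have z0: "map_of_arrow z x = x" if x: "x \<in> univ M0" for x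
    proof -
      have "restrict (h i) (univ M0) x = restrict (h j) (univ M0) x" using eq by (simp add: c_def)
      then show ?thesis using x M(2) i j h(1) by (simp add: z_def subset_iff)
    qed
    have za: "map_of_arrow z (a i x) = a j x" if x: "x \<in> J" for x
    proof -
      have "restrict (\<lambda>x. h i (a i x)) J x = restrict (\<lambda>x. h j (a j x)) J x" using eq by (simp add: c_def)
      then show ?thesis using x M(3) i j h(1) by (simp add: z_def image_subset_iff)
    qed
    have aM: "a i \<in> J \<rightarrow> univ (M i)" "a j \<in> J \<rightarrow> univ (M j)" using M(3) i j by auto
    have "incl_arrow M0 (M j) = z \<cdot> incl_arrow M0 (M i)"
      by (rule arr_eqI) (use z le0 z0 in \<open>auto simp: z_def arr_incl intro!: arr_comp\<close>)
    then have st: "same_type J (incl_arrow M0 (M i)) (a i) (incl_arrow M0 (M j)) (a j)"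
      by (intro same_type_enlarge[of _ _ _ z]) (use z za aM le0 in \<open>auto simp: arr_incl z_def\<close>)
    show ?thesis
      using same_type_incl[OF le0(1) M(1)[OF i] aM(1)] same_type_incl[OF le0(2) M(1)[OF j] aM(2)]
      by (rule same_type_trans[OF same_type_trans[OF same_type_sym st]])
  qed
  ultimately show ?thesis by blast
qed

text \<open>
  Local character speaks of some realization \<open>a'\<close> of the type in some model \<open>N3\<close> that is only
  known to contain the points of \<open>N\<close>. Once \<open>N\<close> is seen to be strong in \<open>N3\<close>,
  independence of \<open>a'\<close> is transferred to the given realization.
\<close>

lemma local_character_free:
  assumes NP: "le K N P" and a: "a \<in> J \<rightarrow>\<^sub>E univ P"
  shows "\<exists>M0. le K M0 N \<and> |univ M0| \<le>o |Y| \<and> free J (incl_arrow M0 N) (incl_arrow N P) a"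
proof -
  have "gtp K J a (univ N) P \<in> gS K J N" using NP a by (auto simp: gS_def)
  then obtain M0 where M0: "le K M0 N" "|univ M0| \<le>o |Y|"
    and nf: "nonforking K ind J (univ N) (gtp K J a (univ N) P) M0"
    using local_character le_modelsD(1)[OF NP] by blast
  obtain a' N3 where N3: "a' \<in> J \<rightarrow>\<^sub>E univ N3" "univ N \<subseteq> univ N3"
    "gtp K J a (univ N) P = gtp K J a' (univ N) N3" "indep_sets K ind M0 (a' ` J) (univ N) N3"
    using nf unfolding nonforking_def by blast
  have "gtp_step K J (a', univ N, N3) (a, univ N, P)"
    using gtp_eq_iff[OF le_modelsD(2)[OF NP] a le_univ[OF NP]] N3(3) by metis
  then obtain g' g where g: "arr g'" "arr g" "src g' = N3" "src g = P" "tgt g' = tgt g"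
    "\<And>b. b \<in> univ N \<Longrightarrow> map_of_arrow g' b = map_of_arrow g b"
    "\<And>j. j \<in> J \<Longrightarrow> map_of_arrow g' (a' j) = map_of_arrow g (a j)"
    unfolding gtp_step_iff by blast
  have NN3: "le K N N3"
    using le_of_agreeing_arrows[OF g(2,1) g(5)[symmetric]] NP N3(2) g by simp
  obtain M1 M2 M3 where M: "a' ` J \<subseteq> univ M1" "univ N \<subseteq> univ M2" "le K N3 M3" "le K M0 M1" "le K M1 M3"
    "le K M0 M2" "le K M2 M3"
    "ind (incl_arrow M0 M1) (incl_arrow M0 M2) (incl_arrow M1 M3) (incl_arrow M2 M3)"
    using N3(4) unfolding indep_sets_def indep_models_def by blast
  have NM2: "le K N M2" by (rule le_coherent[OF le_trans[OF NN3 M(3)] M(7) M(2)])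
  have aM3: "a' \<in> J \<rightarrow> univ M3" using M(1) le_univ[OF M(5)] by auto
  have aN3: "a' \<in> J \<rightarrow> univ N3" "a \<in> J \<rightarrow> univ P" using N3(1) a by auto
  have "free J (incl_arrow M0 M2) (incl_arrow M2 M3) a'"
    by (rule freeI[of _ _ _ "incl_arrow M0 M1" _ "incl_arrow M1 M3" "incl_arrow M3 M3" a'])
      (use M aM3 le_modelsD(2)[OF M(7)] le_refl in
        \<open>auto simp: arr_incl arr_id comp_incl Pi_iff subsetD[OF le_univ[OF M(5)]]\<close>)
  then have "free J (incl_arrow N M2 \<cdot> incl_arrow M0 N) (incl_arrow M2 M3) a'"
    by (simp add: comp_incl[OF M0(1) NM2])
  then have "free J (incl_arrow M0 N) (incl_arrow M2 M3 \<cdot> incl_arrow N M2) a'"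
    by (rule free_mono) (simp_all add: arr_incl M0 NM2)
  then have "free J (incl_arrow M0 N) (incl_arrow N M3) a'" by (simp add: comp_incl[OF NM2 M(7)])
  moreover have "same_type J (incl_arrow N M3) a' (incl_arrow N N3) a'"
    by (rule same_type_sym[OF same_type_incl[OF NN3 M(3) aN3(1)]])
  moreover have "same_type J (incl_arrow N N3) a' (incl_arrow N P) a"
  proof (rule same_typeI[of _ _ _ _ _ g' g])
    show "g' \<cdot> incl_arrow N N3 = g \<cdot> incl_arrow N P"
      by (rule arr_eqI)
        (use g NN3 NP le_univ[OF NN3] le_univ[OF NP] in \<open>auto simp: arr_incl intro!: arr_comp\<close>)
  qed (use g aN3 NN3 NP in \<open>auto simp: arr_incl\<close>)
  ultimately have "free J (incl_arrow M0 N) (incl_arrow N P) a" by (blast intro: free_same_type)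
  with M0 show ?thesis by blast
qed

text \<open>
  Stability. A tuple is independent from \<open>N\<close> over a model of size at most \<open>|Y|\<close>, and by
  uniqueness its type over that model determines its type over \<open>N\<close>. A model of size at most
  \<open>2\<^bsup>|X|\<^esup>\<close> has no more than \<open>2\<^bsup>|X|\<^esup>\<close> submodels of size at most \<open>|Y|\<close>,
  and over each of them there are at most \<open>2\<^bsup>|X|\<^esup>\<close> types.
\<close>

lemma few_types:
  fixes a :: "'i \<Rightarrow> 'u \<Rightarrow> 'u"
  assumes NP: "le K N P" "|univ N| \<le>o |Pow X|" and a: "\<And>j. j \<in> S \<Longrightarrow> a j \<in> J \<rightarrow>\<^sub>E univ P"
  obtains E where "E \<subseteq> S" "|E| \<le>o |Pow X|"
    "\<And>j. j \<in> S \<Longrightarrow> \<exists>i\<in>E. same_type J (incl_arrow N P) (a i) (incl_arrow N P) (a j)"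
proof -
  obtain M where M: "\<And>j. j \<in> S \<Longrightarrow> le K (M j) N" "\<And>j. j \<in> S \<Longrightarrow> |univ (M j)| \<le>o |Y|"
    "\<And>j. j \<in> S \<Longrightarrow> free J (incl_arrow (M j) N) (incl_arrow N P) (a j)"
    using local_character_free[OF NP(1) a] by metis
  let ?D = "{M0. le K M0 N \<and> |univ M0| \<le>o |Y|}"
  have "|?D| \<le>o |Pow X|"
  proof (rule ordLeq_inj[of univ])
    show "inj_on univ ?D" by (rule inj_onI) (auto intro: le_eqI)
    show "univ ` ?D \<subseteq> {B. B \<subseteq> univ N \<and> |B| \<le>o |Y|}" using le_univ by auto
    show "|{B. B \<subseteq> univ N \<and> |B| \<le>o |Y|}| \<le>o |Pow X|"
      by (intro ordLeq_small_subsets X_infinite Y_le_X NP(2))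
  qed
  have "\<exists>c :: 'i \<Rightarrow> ('s, 'u) struct \<times> ('u \<Rightarrow> 'u) \<times> ('u \<Rightarrow> 'u). |c ` S| \<le>o |Pow X| \<and>
      (\<forall>i\<in>S. \<forall>j\<in>S. c i = c j \<longrightarrow> same_type J (incl_arrow M0 P) (a i) (incl_arrow M0 P) (a j))"
    if "M0 \<in> ?D" for M0
    using that a le_trans[OF _ NP(1)] ordLeq_transitive[OF _ Y_le_X]
    by (intro few_types_over_small_model) auto
  then have "\<exists>c :: ('s, 'u) struct \<Rightarrow> 'i \<Rightarrow> ('s, 'u) struct \<times> ('u \<Rightarrow> 'u) \<times> ('u \<Rightarrow> 'u). \<forall>M0\<in>?D.
      |c M0 ` S| \<le>o |Pow X| \<and>
      (\<forall>i\<in>S. \<forall>j\<in>S. c M0 i = c M0 j \<longrightarrow> same_type J (incl_arrow M0 P) (a i) (incl_arrow M0 P) (a j))"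
    by (intro bchoice ballI)
  then obtain c :: "('s, 'u) struct \<Rightarrow> 'i \<Rightarrow> ('s, 'u) struct \<times> ('u \<Rightarrow> 'u) \<times> ('u \<Rightarrow> 'u)"
    where c: "\<And>M0. M0 \<in> ?D \<Longrightarrow> |c M0 ` S| \<le>o |Pow X|"
    "\<And>M0 i j. M0 \<in> ?D \<Longrightarrow> i \<in> S \<Longrightarrow> j \<in> S \<Longrightarrow> c M0 i = c M0 j \<Longrightarrow>
      same_type J (incl_arrow M0 P) (a i) (incl_arrow M0 P) (a j)"
    by blast
  have "|(\<lambda>j. (M j, c (M j) j)) ` S| \<le>o |Pow X|"
  proof (rule ordLeq_subset)
    show "(\<lambda>j. (M j, c (M j) j)) ` S \<subseteq> (SIGMA M0 : ?D. c M0 ` S)" using M by auto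
    show "|SIGMA M0 : ?D. c M0 ` S| \<le>o |Pow X|"
      by (rule card_of_Sigma_ordLeq_infinite[OF PowX_infinite \<open>|?D| \<le>o |Pow X|\<close>]) (use c(1) in blast)
  qed
  then obtain E where E: "E \<subseteq> S" "|E| \<le>o |Pow X|" "\<And>j. j \<in> S \<Longrightarrow> \<exists>i\<in>E. (M i, c (M i) i) = (M j, c (M j) j)"
    using representatives by (metis (no_types, lifting))
  show thesis
  proof (rule that[OF E(1,2)])
    fix j assume j: "j \<in> S"
    from E(3)[OF j] obtain i where i: "i \<in> E" "M i = M j" "c (M i) i = c (M j) j"
      unfolding prod.inject by blast
    then have iS: "i \<in> S" using E(1) by blast
    have "same_type J (incl_arrow (M j) P) (a i) (incl_arrow (M j) P) (a j)"
      using c(2)[of "M j" i j] M(1,2)[OF j] i j iS by simp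
    then have "same_type J (incl_arrow N P) (a i) (incl_arrow N P) (a j)"
      using free_type_unique[of J "incl_arrow (M j) N" "incl_arrow N P" "a i" "a j"] M(3)[OF j] M(3)[OF iS]
        i(2) comp_incl[OF M(1)[OF j] NP(1)] by simp
    with i(1) show "\<exists>i\<in>E. same_type J (incl_arrow N P) (a i) (incl_arrow N P) (a j)" by blast
  qed
qed

end


section \<open>One forking step\<close>

context bounded_independence
begin

lemma same_type_swap:
  assumes "same_type (I <+> I) f (case_sum a b) f' (case_sum a' b')"
  shows "same_type (I <+> I) f (case_sum b a) f' (case_sum b' a')"
proof -
  obtain g g' where g: "arr f" "arr f'" "case_sum a b \<in> I <+> I \<rightarrow> univ (tgt f)"
    "case_sum a' b' \<in> I <+> I \<rightarrow> univ (tgt f')"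
    "arr g" "arr g'" "src g = tgt f" "src g' = tgt f'" "tgt g = tgt g'" "g \<cdot> f = g' \<cdot> f'"
    "\<And>j. j \<in> I <+> I \<Longrightarrow> map_of_arrow g (case_sum a b j) = map_of_arrow g' (case_sum a' b' j)"
    using assms unfolding same_type_def by blast
  have 1: "a \<in> I \<rightarrow> univ (tgt f)" "b \<in> I \<rightarrow> univ (tgt f)"
    using funcset_mem[OF g(3) InlI] funcset_mem[OF g(3) InrI] by auto
  have 2: "a' \<in> I \<rightarrow> univ (tgt f')" "b' \<in> I \<rightarrow> univ (tgt f')"
    using funcset_mem[OF g(4) InlI] funcset_mem[OF g(4) InrI] by auto
  show ?thesis
    by (rule same_typeI[OF g(1,2) _ _ g(5-10)])
      (use 1 2 g(11)[OF InlI] g(11)[OF InrI] in \<open>auto split: sum.split\<close>)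
qed

text \<open>
  The order property over the empty set, in the form in which it is used: no extension of
  \<open>P0\<close> makes an ordered pair and its reverse alike over any of its submodels. A submodel
  \<open>N\<close> occurs because the base of \<open>same_type\<close> is an arrow.
\<close>

definition asymmetric_family ::
    "('s, 'u) struct \<Rightarrow> 'i set \<Rightarrow> ('i \<Rightarrow> 'u \<Rightarrow> 'u) \<Rightarrow> bool" where
  "asymmetric_family P0 S a \<longleftrightarrow>
     (\<forall>j\<in>S. a j \<in> J \<rightarrow>\<^sub>E univ P0) \<and>
     (\<forall>N R i j. le K P0 R \<and> le K N R \<and> i \<in> S \<and> j \<in> S \<and> i \<noteq> j \<longrightarrow>
        \<not> same_type (J <+> J) (incl_arrow N R) (case_sum (a i) (a j)) (incl_arrow N R) (case_sum (a j) (a i)))"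

text \<open>
  The ambient model passes from \<open>P\<close> to \<open>P'\<close> and the small model from \<open>N\<close> to
  \<open>N'\<close>, so that all members of the family with index outside \<open>E\<close> fork with \<open>N'\<close>
  over \<open>N\<close>.
\<close>

definition forking_step ::
    "'i set \<Rightarrow> ('i \<Rightarrow> 'u \<Rightarrow> 'u) \<Rightarrow>
       ('s, 'u) struct \<Rightarrow> ('s, 'u) struct \<Rightarrow> ('s, 'u) struct \<Rightarrow> ('s, 'u) struct \<Rightarrow> 'i set \<Rightarrow> bool" where
  "forking_step S a P N P' N' E \<longleftrightarrow>
     le K P P' \<and> le K N N' \<and> le K N' P' \<and> |univ N'| \<le>o |Pow X| \<and> |E| \<le>o |Pow X| \<and>
     (\<forall>j\<in>S - E. \<forall>R. le K P' R \<longrightarrow> \<not> free J (incl_arrow N N') (incl_arrow N' R) (a j))"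

text \<open>
  \<open>N'\<close> contains a representative \<open>a i\<close> of each type over \<open>N\<close>. If \<open>a j\<close> of the same
  type were independent from \<open>N'\<close>, then by symmetry \<open>a i\<close> would also be independent from
  \<open>a j\<close>, and uniqueness would identify the pair with its reverse.
\<close>

lemma forking_step_symmetric:
  assumes sym: "symmetric ind" and fam: "asymmetric_family P0 S a"
    and P: "le K P0 P" and N: "le K N P" "|univ N| \<le>o |Pow X|"
  shows "\<exists>N' E. forking_step S a P N P N' E"
proof -
  have aP: "a j \<in> J \<rightarrow>\<^sub>E univ P" if "j \<in> S" for j
    using fam that le_univ[OF P] by (auto simp: asymmetric_family_def)
  obtain E where E: "E \<subseteq> S" "|E| \<le>o |Pow X|"
    "\<And>j. j \<in> S \<Longrightarrow> \<exists>i\<in>E. same_type J (incl_arrow N P) (a i) (incl_arrow N P) (a j)"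
    using few_types[OF N, of S a, OF aP] by blast
  have "|\<Union>i\<in>E. a i ` J| \<le>o |Pow X|"
    by (rule card_of_UNION_ordLeq_infinite[OF PowX_infinite E(2)])
      (intro ballI ordLeq_image ordLeq_Pow_self ordLeq_transitive[OF J_bound Y_le_X])
  then obtain N' where N': "le K N' P" "univ N \<union> (\<Union>i\<in>E. a i ` J) \<subseteq> univ N'" "|univ N'| \<le>o |Pow X|"
    using LST_PowX[OF le_modelsD(2)[OF P], of "univ N \<union> (\<Union>i\<in>E. a i ` J)"] le_univ[OF N(1)] aP E(1)
      ordLeq_Un[OF PowX_infinite N(2)] by (auto simp: PiE_iff subset_iff) 
  have NN': "le K N N'" using le_coherent[OF N(1) N'(1)] N'(2) by auto
  have forks: "\<not> free J (incl_arrow N N') (incl_arrow N' R) (a j)" if j: "j \<in> S - E" and R: "le K P R" for j R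
  proof
    assume fr: "free J (incl_arrow N N') (incl_arrow N' R) (a j)"
    obtain i where i: "i \<in> E" "same_type J (incl_arrow N P) (a i) (incl_arrow N P) (a j)" using E(3) j by blast
    have N'R: "le K N' R" by (rule le_trans[OF N'(1) R])
    have NR: "le K N R" by (rule le_trans[OF N(1) R])
    have "a i ` J \<subseteq> univ N'" using N'(2) i(1) by blast
    then have ai: "a i \<in> J \<rightarrow> univ N'" "a i \<in> J \<rightarrow> univ R" and aj: "a j \<in> J \<rightarrow> univ R"
      using j aP[of j] le_univ[OF N'R] le_univ[OF R] by auto
    have ij: "same_type J (incl_arrow N R) (a i) (incl_arrow N R) (a j)"
      by (rule same_type_in_extension[OF N(1) R i(2)])
    obtain f1 u1 r x where F: "ind f1 (incl_arrow N N') u1 (r \<cdot> incl_arrow N' R)" "arr r"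
      "src r = tgt (incl_arrow N' R)" "x \<in> J \<rightarrow> univ (tgt f1)"
      "\<And>k. k \<in> J \<Longrightarrow> map_of_arrow r (a j k) = map_of_arrow u1 (x k)" "tgt r = tgt u1"
      using freeE[OF fr] by metis
    note D = indD[OF F(1)]
    let ?ri = "\<lambda>k. map_of_arrow r (a i k)"
    have rinc: "u1 \<cdot> f1 = r \<cdot> incl_arrow N R"
      using D(9) F(2,3) by (simp add: comp_assoc arr_incl NN' N'R comp_incl)
    have ind': "ind (incl_arrow N N') f1 (r \<cdot> incl_arrow N' R) u1"
      using sym F(1) unfolding symmetric_def dual_def by metis
    have ri: "map_of_arrow r (a i k) \<in> univ (tgt u1)" if "k \<in> J" for k
      using arr_map[OF F(2), of "a i k"] that ai F(3,6) by (simp add: Pi_iff)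
    \<comment> \<open>the square that witnesses independence of \<open>a j\<close> from \<open>N'\<close>, reflected\<close>
    have fr': "free J f1 u1 ?ri"
    proof (rule freeI[of _ _ _ "incl_arrow N N'" _ "r \<cdot> incl_arrow N' R" "incl_arrow (tgt u1) (tgt u1)" "a i"])
      show "ind (incl_arrow N N') f1 (r \<cdot> incl_arrow N' R) (incl_arrow (tgt u1) (tgt u1) \<cdot> u1)"
        using ind' id_comp[OF D(3)] by simp
    qed (use D F(3) ai ri arr_models[OF D(3)] N'R in \<open>simp_all add: arr_id Pi_iff\<close>)
    have t1: "same_type J (incl_arrow N R) (a i) (u1 \<cdot> f1) ?ri"
      by (rule same_type_enlarge[of _ _ _ r]) (use F ai rinc NR in \<open>auto simp: arr_incl\<close>)
    have t2: "same_type J (incl_arrow N R) (a j) (u1 \<cdot> f1) (\<lambda>k. map_of_arrow u1 (x k))"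
      by (rule same_type_enlarge[of _ _ _ r]) (use F aj rinc NR in \<open>auto simp: arr_incl\<close>)
    have t3: "same_type J f1 x (u1 \<cdot> f1) (\<lambda>k. map_of_arrow u1 (x k))"
      by (rule same_type_enlarge[of _ _ _ u1]) (use F D in auto)
    have t4: "same_type J (incl_arrow N N') (a i) (incl_arrow N R) (a i)"
      by (rule same_type_incl[OF NN' N'R ai(1)])
    have aa: "same_type J (u1 \<cdot> f1) ?ri (incl_arrow N' R \<cdot> incl_arrow N N') (a j)"
      using same_type_trans[OF same_type_sym[OF t1] ij] by (simp add: comp_incl[OF NN' N'R])
    have bb: "same_type J f1 x (incl_arrow N N') (a i)"
      using same_type_trans[OF same_type_trans[OF t3 same_type_sym[OF t2]]
          same_type_trans[OF same_type_sym[OF ij] same_type_sym[OF t4]]] .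
    have "same_type (J <+> J) (u1 \<cdot> f1) (case_sum ?ri (\<lambda>k. map_of_arrow u1 (x k)))
        (incl_arrow N' R \<cdot> incl_arrow N N') (case_sum (a j) (\<lambda>k. map_of_arrow (incl_arrow N' R) (a i k)))"
      by (rule free_pair_type_unique[OF fr' fr aa bb])
    then have "same_type (J <+> J) (u1 \<cdot> f1) (case_sum ?ri (\<lambda>k. map_of_arrow u1 (x k)))
        (incl_arrow N R) (case_sum (a j) (a i))"
      unfolding comp_incl[OF NN' N'R]
      by (rule same_type_cong) (use ai(1) in \<open>auto simp: Pi_iff split: sum.split\<close>)
    moreover have "same_type (J <+> J) (incl_arrow N R) (case_sum (a i) (a j))
        (u1 \<cdot> f1) (case_sum ?ri (\<lambda>k. map_of_arrow u1 (x k)))"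
      by (rule same_type_enlarge[of _ _ _ r])
        (use F ai aj rinc NR in \<open>auto simp: arr_incl Pi_iff split: sum.split\<close>)
    ultimately have "same_type (J <+> J) (incl_arrow N R) (case_sum (a i) (a j)) (incl_arrow N R) (case_sum (a j) (a i))"
      by (rule same_type_trans[rotated])
    moreover have "i \<in> S" "j \<in> S" "i \<noteq> j" using i(1) j E(1) by auto
    ultimately show False using fam le_trans[OF P R] NR unfolding asymmetric_family_def by blast
  qed
  have "forking_step S a P N P N' E"
    unfolding forking_step_def
    by (intro conjI ballI allI impI le_refl[OF le_modelsD(2)[OF P]] NN' N'(1,3) E(2) forks)
  then show ?thesis by blast
qed

text \<open>
  In place of symmetry a copy \<open>e i\<close> of \<open>a i\<close> over \<open>N\<close> is adjoined that is independent
  from \<open>P\<close>, hence from \<open>a j\<close>. It comes from an independent amalgam of two copies of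
  \<open>P\<close> over \<open>N\<close>.
\<close>

lemma forking_step_extension:
  assumes fam: "asymmetric_family P0 S a"
    and P: "le K P0 P" and N: "le K N P" "|univ N| \<le>o |Pow X|"
  shows "\<exists>P' N' E. forking_step S a P N P' N' E"
proof -
  have aP: "a j \<in> J \<rightarrow>\<^sub>E univ P" if "j \<in> S" for j
    using fam that le_univ[OF P] by (auto simp: asymmetric_family_def)
  obtain E where E: "E \<subseteq> S" "|E| \<le>o |Pow X|"
    "\<And>j. j \<in> S \<Longrightarrow> \<exists>i\<in>E. same_type J (incl_arrow N P) (a i) (incl_arrow N P) (a j)"
    using few_types[OF N, of S a, OF aP] by blast
  obtain u v where uv: "ind (incl_arrow N P) (incl_arrow N P) u v"
    using ind_exists[of "incl_arrow N P" "incl_arrow N P"] N(1) by (auto simp: arr_incl)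
  note D = indD[OF uv]
  obtain P' z where z: "le K P P'" "arr z" "src z = tgt v" "tgt z = P'" "z \<cdot> v = incl_arrow P P'"
    using arrow_as_inclusion[OF D(4)] D by auto
  let ?e = "\<lambda>i k. map_of_arrow (z \<cdot> u) (a i k)"
  have zu: "arr (z \<cdot> u)" "src (z \<cdot> u) = P" "tgt (z \<cdot> u) = P'" using z D by (auto intro!: arr_comp)
  have indz: "ind (incl_arrow N P) (incl_arrow N P) (z \<cdot> u) (incl_arrow P P')"
    using ind_enlarge[OF uv z(2)] z D by simp
  have eP': "?e i \<in> J \<rightarrow> univ P'" if "i \<in> S" for i
  proof (rule funcsetI)
    fix k assume "k \<in> J"
    then have "a i k \<in> univ (src (z \<cdot> u))" using aP[OF that] zu(2) by auto
    from arr_map[OF zu(1) this] show "?e i k \<in> univ P'" by (simp only: zu(3))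
  qed
  let ?A = "univ N \<union> ((\<Union>i\<in>E. a i ` J) \<union> (\<Union>i\<in>E. ?e i ` J))"
  have J': "|J| \<le>o |Pow X|" by (rule ordLeq_Pow_self[OF ordLeq_transitive[OF J_bound Y_le_X]])
  have cA: "|?A| \<le>o |Pow X|"
    by (intro ordLeq_Un PowX_infinite N(2) card_of_UNION_ordLeq_infinite E(2) ballI ordLeq_image J')
  have "?A \<subseteq> univ P'"
  proof (intro Un_least UN_least)
    show "univ N \<subseteq> univ P'" using le_univ[OF N(1)] le_univ[OF z(1)] by (rule subset_trans)
    fix i assume "i \<in> E"
    then have i: "i \<in> S" using E(1) by blast
    show "a i ` J \<subseteq> univ P'" using aP[OF i] le_univ[OF z(1)] by auto
    show "?e i ` J \<subseteq> univ P'" using eP'[OF i] by (simp only: image_subset_iff_funcset)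
  qed
  then obtain N' where N': "le K N' P'" "?A \<subseteq> univ N'" "|univ N'| \<le>o |Pow X|"
    using LST_PowX[OF le_modelsD(2)[OF z(1)] _ cA] by blast
  have NP': "le K N P'" by (rule le_trans[OF N(1) z(1)])
  have NN': "le K N N'" using le_coherent[OF NP' N'(1)] N'(2) by auto
  have forks: "\<not> free J (incl_arrow N N') (incl_arrow N' R) (a j)" if j: "j \<in> S - E" and R: "le K P' R" for j R
  proof
    assume fr: "free J (incl_arrow N N') (incl_arrow N' R) (a j)"
    obtain i where i: "i \<in> E" "same_type J (incl_arrow N P) (a i) (incl_arrow N P) (a j)" using E(3) j by blast
    have iS: "i \<in> S" and jS: "j \<in> S" using i(1) j E(1) by auto
    have PR: "le K P R" by (rule le_trans[OF z(1) R])
    have N'R: "le K N' R" by (rule le_trans[OF N'(1) R])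
    have NR: "le K N R" by (rule le_trans[OF NP' R])
    have mem: "a i \<in> J \<rightarrow> univ N'" "?e i \<in> J \<rightarrow> univ N'" "a i \<in> J \<rightarrow> univ P" "a j \<in> J \<rightarrow> univ P"
    proof -
      have "a i ` J \<subseteq> univ N'" "?e i ` J \<subseteq> univ N'" using N'(2) i(1) by blast+
      then show "a i \<in> J \<rightarrow> univ N'" "?e i \<in> J \<rightarrow> univ N'" by auto
    qed (use aP[OF iS] aP[OF jS] in auto)
    have mem': "a i \<in> J \<rightarrow> univ R" "?e i \<in> J \<rightarrow> univ R" "a j \<in> J \<rightarrow> univ R"
      using mem le_univ[OF N'R] le_univ[OF PR] by auto
    have ij: "same_type J (incl_arrow N R) (a i) (incl_arrow N R) (a j)"
      by (rule same_type_in_extension[OF N(1) PR i(2)])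
    have ieP: "same_type J (incl_arrow N P) (a i) (incl_arrow N P') (?e i)"
    proof (rule same_type_enlarge[of _ _ _ "z \<cdot> u"])
      show "incl_arrow N P' = (z \<cdot> u) \<cdot> incl_arrow N P"
        using indD(9)[OF indz] by (simp add: comp_incl[OF N(1) z(1)])
    qed (use zu mem N in \<open>auto simp: arr_incl\<close>)
    have ie: "same_type J (incl_arrow N R) (a i) (incl_arrow N R) (?e i)"
      by (rule same_type_trans[OF same_type_trans[OF same_type_sym[OF same_type_incl[OF N(1) PR mem(3)]] ieP]
            same_type_incl[OF NP' R eP'[OF iS]]])
    have "free J (incl_arrow N P) (incl_arrow P P') (?e i)"
    proof (rule freeI[of _ _ _ "incl_arrow N P" _ "z \<cdot> u" "incl_arrow P' P'" "a i"])
      show "ind (incl_arrow N P) (incl_arrow N P) (z \<cdot> u) (incl_arrow P' P' \<cdot> incl_arrow P P')"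
        using indz id_comp[OF arr_incl[OF z(1)]] by simp
    qed (use z zu eP'[OF iS] mem le_modelsD(2)[OF z(1)] arr_map[OF zu(1)] in \<open>auto simp: arr_id arr_incl Pi_iff\<close>)
    then have fre: "free J (incl_arrow N P) (incl_arrow P R) (?e i)"
      by (rule free_same_type) (rule same_type_incl[OF z(1) R eP'[OF iS]])
    have inN': "same_type J (incl_arrow N N') b (incl_arrow N N') c"
      if "same_type J (incl_arrow N R) b (incl_arrow N R) c" "b \<in> J \<rightarrow> univ N'" "c \<in> J \<rightarrow> univ N'" for b c
      using same_type_trans[OF same_type_trans[OF same_type_incl[OF NN' N'R that(2)] that(1)]
            same_type_sym[OF same_type_incl[OF NN' N'R that(3)]]] .
    let ?pair = "\<lambda>b c. same_type (J <+> J) (incl_arrow N R) b (incl_arrow N R) c"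
    \<comment> \<open>\<open>a j\<close> is independent from \<open>N'\<close>, which contains both \<open>a i\<close> and \<open>e i\<close>\<close>
    have 1: "?pair (case_sum (a j) (?e i)) (case_sum (a j) (a i))"
    proof -
      have "same_type J (incl_arrow N' R \<cdot> incl_arrow N N') (a j) (incl_arrow N' R \<cdot> incl_arrow N N') (a j)"
        unfolding comp_incl[OF NN' N'R] by (rule same_type_refl) (use NR mem'(3) in \<open>simp_all add: arr_incl\<close>)
      from free_pair_type_unique[OF fr fr this inN'[OF same_type_sym[OF ie] mem(2,1)]]
      show ?thesis unfolding comp_incl[OF NN' N'R]
        by (rule same_type_cong) (use mem in \<open>auto simp: Pi_iff split: sum.split\<close>)
    qed
    \<comment> \<open>\<open>e i\<close> is independent from \<open>P\<close>, which contains \<open>a j\<close>\<close>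
    have 2: "?pair (case_sum (?e i) (a j)) (case_sum (a j) (a i))"
    proof -
      have aa: "same_type J (incl_arrow P R \<cdot> incl_arrow N P) (?e i) (incl_arrow N' R \<cdot> incl_arrow N N') (a j)"
        unfolding comp_incl[OF NN' N'R] comp_incl[OF N(1) PR]
        by (rule same_type_trans[OF same_type_sym[OF ie] ij])
      have bb: "same_type J (incl_arrow N P) (a j) (incl_arrow N N') (a i)"
        by (rule same_type_trans[OF same_type_trans[OF same_type_incl[OF N(1) PR mem(4)] same_type_sym[OF ij]]
            same_type_sym[OF same_type_incl[OF NN' N'R mem(1)]]])
      from free_pair_type_unique[OF fre fr aa bb]
      show ?thesis unfolding comp_incl[OF NN' N'R] comp_incl[OF N(1) PR]
        by (rule same_type_cong) (use mem in \<open>auto simp: Pi_iff split: sum.split\<close>)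
    qed
    have "?pair (case_sum (a i) (a j)) (case_sum (a j) (a i))"
      by (rule same_type_trans[OF same_type_sym[OF same_type_swap[OF 1]] 2])
    moreover have "i \<noteq> j" using i(1) j by auto
    ultimately show False using fam le_trans[OF P PR] NR iS jS unfolding asymmetric_family_def by blast
  qed
  have "forking_step S a P N P' N' E"
    unfolding forking_step_def by (intro conjI ballI allI impI z(1) NN' N'(1,3) E(2) forks)
  then show ?thesis by blast
qed

end


section \<open>Iterating the step\<close>

context mu_AEC
begin

lemma small_copy:
  assumes "|A| <o |UNIV :: 'u set|"
  obtains B :: "'u set" where "|B| =o |A|" "small B"
proof -
  obtain f :: "_ \<Rightarrow> 'u" where f: "inj_on f A" using card_of_ordLeq[of A UNIV] ordLess_imp_ordLeq[OF assms] by auto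
  have "|f ` A| =o |A|" using card_of_ordIso[of A "f ` A"] f by (auto simp: bij_betw_def ordIso_symmetric)
  moreover have "small (f ` A)" unfolding small_def by (rule ordIso_ordLess_trans[OF calculation assms])
  ultimately show thesis using that by blast
qed

lemma small_Pow: "small (A :: 'u set) \<Longrightarrow> |Pow A| <o |UNIV :: 'u set|"
  using inaccessible unfolding inaccessible_universe_def small_def by blast

end

text \<open>
  A stage records the models before (\<open>inner\<close>) and after (\<open>outer\<close>) one forking step.
  Keeping both lets a later stage start from any models above the outer ones of all earlier stages.
\<close>

record ('s, 'u, 'i) stage =
  inner_ambient :: "('s, 'u) struct"
  inner :: "('s, 'u) struct"
  outer_ambient :: "('s, 'u) struct"
  outer :: "('s, 'u) struct"
  spoiled :: "'i set"

context bounded_independence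
begin

text \<open>
  The class \<open>PP\<close> collects the admissible ambient models: only \<open>P0\<close> if the step does not
  enlarge them, all extensions of \<open>P0\<close> if chains have bounds. Each stage applies the forking step
  to an upper bound of the ambient models and a small model above those reached so far, so that
  successor and limit stages need no distinction. The length of the iteration is the successor
  of \<open>|Y|\<close>, which is regular and greater than \<open>\<mu>\<close>, so the union of the small models is a model.
\<close>

lemma no_large_asymmetric_family:
  fixes S :: "'i set" and PP :: "('s, 'u) struct \<Rightarrow> bool"
  assumes X_small: "small X"
    and fam: "asymmetric_family P0 S a" and S: "\<not> |S| \<le>o |Pow X|"
    and P0: "PP P0" and PP: "\<And>P. PP P \<Longrightarrow> le K P0 P"
    and bounds: "\<And>(d :: 'u rel) M. is_ordinal d \<Longrightarrow> (\<And>i. i \<in> Field d \<Longrightarrow> PP (M i)) \<Longrightarrow>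
      (\<And>i j. (i, j) \<in> d \<Longrightarrow> le K (M i) (M j)) \<Longrightarrow> \<exists>R. PP R \<and> (\<forall>i\<in>Field d. le K (M i) R)"
    and step: "\<And>P N. PP P \<Longrightarrow> le K N P \<Longrightarrow> |univ N| \<le>o |Pow X| \<Longrightarrow>
      \<exists>P' N' E. PP P' \<and> forking_step S a P N P' N' E"
  shows False
proof -
  have "|Field (cardSuc |Y| )| =o cardSuc |Y|"
    using card_of_Field_ordIso cardSuc_Card_order card_of_Card_order by blast
  moreover have sucX: "cardSuc |Y| \<le>o |X|"
  proof -
    have "cardSuc |Y| \<le>o |Pow Y|"
      using cardSuc_ordLess_ordLeq[OF card_of_Card_order card_of_Card_order] card_of_Pow by blast
    then show ?thesis using ordLeq_ordIso_trans ordIso_symmetric[OF X_Pow] by blast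
  qed
  ultimately have FX: "|Field (cardSuc |Y| )| \<le>o |X|" using ordIso_ordLeq_trans by blast
  then obtain D :: "'u set" where D: "|D| =o |Field (cardSuc |Y| )|" "small D"
    using small_copy X_small unfolding small_def by (metis ordLeq_ordLess_trans)
  define d where "d = |D|"
  have Dsuc: "d =o cardSuc |Y|" unfolding d_def
    by (rule ordIso_transitive[OF D(1) \<open>|Field (cardSuc |Y| )| =o cardSuc |Y|\<close>])
  have Fd: "Field d = D" by (simp add: d_def Field_card_of)
  have d: "Card_order d" by (simp add: d_def card_of_Card_order)
  have wo: "Well_order d" by (simp add: d_def card_of_Well_order)
  have DX: "|D| \<le>o |X|" by (rule ordIso_ordLeq_trans[OF D(1) FX])
  have reg: "regularCard d"
  proof (rule regularCard_ordIso[OF ordIso_symmetric[OF Dsuc]])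
    show "Cinfinite (cardSuc |Y| )"
      by (rule Cinfinite_cardSuc) (simp add: cinfinite_def Y_infinite Field_card_of card_of_card_order_on)
    show "regularCard (cardSuc |Y| )"
      by (rule infinite_cardSuc_regularCard) (simp_all add: Y_infinite Field_card_of card_of_card_order_on)
  qed
  have Yd: "|Y| <o d" by (rule ordLess_ordIso_trans[OF cardSuc_greater[OF card_of_Card_order] ordIso_symmetric[OF Dsuc]])
  have Dinf: "\<not> finite D"
    using infinite_ordLeq[OF Y_infinite] Yd ordLess_imp_ordLeq unfolding d_def by blast
  have refl_d: "(i, i) \<in> d" if "i \<in> D" for i
    using wo that Fd by (auto simp: well_order_on_def linear_order_on_def partial_order_on_def preorder_on_def refl_on_def)
  have underS_D: "underS d i \<subseteq> D" for i using Fd by (auto simp: underS_def Field_def)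
  define good :: "('s, 'u, 'i) stage \<Rightarrow> bool" where "good s \<longleftrightarrow> PP (inner_ambient s) \<and> PP (outer_ambient s) \<and> le K (inner s) (inner_ambient s) \<and>
      forking_step S a (inner_ambient s) (inner s) (outer_ambient s) (outer s) (spoiled s)" for s
  define below :: "('s, 'u, 'i) stage \<Rightarrow> ('s, 'u, 'i) stage \<Rightarrow> bool" where "below s t \<longleftrightarrow> le K (outer_ambient s) (inner_ambient t) \<and> univ (outer s) \<subseteq> univ (inner t)" for s t
  define Q where "Q f i s \<longleftrightarrow> (i \<in> D \<longrightarrow> good s \<and> (\<forall>j\<in>underS d i. below (f j) s))" for f i s
  have goodD: "PP (inner_ambient s)" "PP (outer_ambient s)" "le K (inner s) (inner_ambient s)" "le K (inner_ambient s) (outer_ambient s)"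
    "le K (inner s) (outer s)" "le K (outer s) (outer_ambient s)" "|univ (outer s)| \<le>o |Pow X|" "|spoiled s| \<le>o |Pow X|"
    "\<And>j R. j \<in> S - spoiled s \<Longrightarrow> le K (outer_ambient s) R \<Longrightarrow>
      \<not> free J (incl_arrow (inner s) (outer s)) (incl_arrow (outer s) R) (a j)" if "good s" for s
    using that unfolding good_def forking_step_def by blast+
  have "\<exists>f. \<forall>i. Q f i (f i)"
  proof (rule dependent_wf_choice[of "d - Id"])
    show "wf (d - Id)" using wo by (simp add: well_order_on_def)
    show "Q f i s = Q g i s" if "\<And>j. (j, i) \<in> d - Id \<Longrightarrow> f j = g j" for f g i s
      using that by (auto simp: Q_def underS_def)
    fix i f
    assume IH: "\<And>j. (j, i) \<in> d - Id \<Longrightarrow> Q f j (f j)"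
    show "\<exists>s. Q f i s"
    proof (cases "i \<in> D")
      case False
      then show ?thesis by (simp add: Q_def)
    next
      case True
      let ?U = "underS d i"
      have good: "good (f j)" and below: "\<And>k. k \<in> underS d j \<Longrightarrow> below (f k) (f j)" if "j \<in> ?U" for j
        using IH[of j] that underS_D by (auto simp: Q_def underS_def)
      have FU: "Field (Restr d ?U) = ?U"
        using Field_Restr_subset[of d ?U] refl_d underS_D[of i] by (force simp: Field_def)
      have "is_ordinal (Restr d ?U)"
        unfolding is_ordinal_def FU small_def
        using Well_order_Restr[OF wo, of ?U, unfolded FU] ordLeq_ordLess_trans[OF card_of_mono1[OF underS_D[of i]]] D(2)
        by (auto simp: small_def)
      moreover have "PP (outer_ambient (f j))" if "j \<in> Field (Restr d ?U)" for j
        using goodD(2)[OF good] that unfolding FU by blast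
      moreover have "le K (outer_ambient (f j)) (outer_ambient (f k))" if jk: "(j, k) \<in> Restr d ?U" for j k
      proof (cases "j = k")
        case True
        then show ?thesis using jk PP goodD(2)[OF good] by (blast intro: le_refl le_modelsD(2))
      next
        case False
        then have "below (f j) (f k)" using jk below by (auto simp: underS_def)
        then show ?thesis using le_trans goodD(4)[OF good] jk unfolding below_def by blast
      qed
      ultimately obtain R where R: "PP R" "\<And>j. j \<in> ?U \<Longrightarrow> le K (outer_ambient (f j)) R"
        using bounds[of "Restr d ?U" "\<lambda>j. outer_ambient (f j)"] unfolding FU by blast
      have sub: "(\<Union>j\<in>?U. univ (outer (f j))) \<subseteq> univ R"
        using le_univ[OF le_trans[OF goodD(6)[OF good] R(2)]] by blast
      have "|\<Union>j\<in>?U. univ (outer (f j))| \<le>o |Pow X|"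
        by (rule card_of_UNION_ordLeq_infinite[OF PowX_infinite])
          (use goodD(7)[OF good] ordLeq_subset[OF underS_D[of i] ordLeq_Pow_self[OF DX]] in auto)
      then obtain N where N: "le K N R" "(\<Union>j\<in>?U. univ (outer (f j))) \<subseteq> univ N" "|univ N| \<le>o |Pow X|"
        using LST_PowX[OF le_modelsD(2)[OF PP[OF R(1)]] sub] by blast
      obtain P' N' E where E: "PP P'" "forking_step S a R N P' N' E" using step[OF R(1) N(1,3)] by blast
      let ?s = "\<lparr>inner_ambient = R, inner = N, outer_ambient = P', outer = N', spoiled = E\<rparr>"
      have "good ?s" using R(1) E N(1) by (simp add: good_def)
      moreover have "below (f j) ?s" if "j \<in> ?U" for j
        using R(2)[OF that] N(2) that unfolding below_def by auto
      ultimately show ?thesis unfolding Q_def by blast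
    qed
  qed
  then obtain f where "\<forall>i. Q f i (f i)" by blast
  then have good: "good (f i)" and below: "\<And>j. j \<in> underS d i \<Longrightarrow> below (f j) (f i)" if "i \<in> D" for i
    using that by (auto simp: Q_def)
  let ?N' = "\<lambda>i. outer (f i)" and ?P' = "\<lambda>i. outer_ambient (f i)"
  have mono: "le K (?P' i) (?P' j)" "univ (?N' i) \<subseteq> univ (?N' j)" if ij: "(i, j) \<in> d" for i j
  proof -
    have D: "i \<in> D" "j \<in> D" using ij Fd by (auto simp: Field_def)
    have "le K (?P' i) (?P' j) \<and> univ (?N' i) \<subseteq> univ (?N' j)"
    proof (cases "i = j")
      case True
      then show ?thesis using PP goodD(2)[OF good] D by (blast intro: le_refl le_modelsD(2))
    next
      case False
      then have "below (f i) (f j)" using ij below D by (auto simp: underS_def)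
      then show ?thesis
        using le_trans goodD(4)[OF good[OF D(2)]] le_univ[OF goodD(5)[OF good[OF D(2)]]] unfolding below_def by blast
    qed
    then show "le K (?P' i) (?P' j)" "univ (?N' i) \<subseteq> univ (?N' j)" by auto
  qed
  have "\<exists>R. PP R \<and> (\<forall>i\<in>Field d. le K (?P' i) R)"
  proof (rule bounds)
    show "is_ordinal d" unfolding is_ordinal_def using wo D(2) Fd by simp
    show "PP (?P' i)" if "i \<in> Field d" for i using goodD(2)[OF good] that unfolding Fd by blast
  qed (rule mono(1))
  then obtain R where R: "PP R" "\<And>i. i \<in> D \<Longrightarrow> le K (?P' i) R" unfolding Fd by blast
  have N'R: "le K (?N' i) R" if "i \<in> D" for i using le_trans[OF goodD(6)[OF good] R(2)] that by blast
  have dir: "directed_system K D d ?N'" unfolding directed_system_def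
  proof (intro conjI allI impI ballI)
    show "small D" by (rule D(2))
    show "partial_order_on D d" using wo Fd by (simp add: well_order_on_def linear_order_on_def)
    show "?N' i \<in> models K" if "i \<in> D" for i by (rule le_modelsD(1)[OF N'R[OF that]])
    show "case p of (i, j) \<Rightarrow> le K (?N' i) (?N' j)" if "p \<in> d" for p
    proof -
      obtain i j where p: "p = (i, j)" by (cases p)
      have "i \<in> D" "j \<in> D" using that p Fd by (auto simp: Field_def)
      then show ?thesis using le_coherent[OF N'R N'R mono(2)] that p by simp
    qed
    fix A assume A: "A \<subseteq> D \<and> |A| <o mu K"
    have "Card_order (mu K)" using mu_AEC unfolding is_mu_AEC_def is_regular_cardinal_def is_cardinal_def by blast
    then have "mu K =o |Field (mu K)|" using card_of_Field_ordIso ordIso_symmetric by blast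
    then have "|A| <o d"
      using A mu_bound Yd ordLess_ordIso_trans ordLess_ordLeq_trans ordLess_transitive by blast
    then have "\<exists>i\<in>Field d. A \<subseteq> under d i"
    proof (rule regularCard_UNION[OF d reg, rotated 2])
      show "relChain d (under d)" unfolding relChain_def using under_incr[of d] wo
        by (auto simp: well_order_on_def linear_order_on_def partial_order_on_def preorder_on_def)
      show "A \<subseteq> (\<Union>i\<in>Field d. under d i)" using A refl_d Fd by (auto simp: under_def)
    qed
    then show "\<exists>b\<in>D. \<forall>a\<in>A. (a, b) \<in> d" unfolding Fd under_def by blast
  qed
  define NN where "NN = union_struct K D ?N'"
  have chain: "NN \<in> models K \<and> (\<forall>i\<in>D. le K (?N' i) NN) \<and> (\<forall>M\<in>models K. (\<forall>i\<in>D. le K (?N' i) M) \<longrightarrow> le K NN M)"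
    using mu_AEC dir unfolding is_mu_AEC_def chain_axioms_def NN_def by blast
  then have NNR: "le K NN R" and N'N: "\<And>i. i \<in> D \<Longrightarrow> le K (?N' i) NN"
    using N'R le_modelsD(2)[OF PP[OF R(1)]] by blast+
  \<comment> \<open>all stages together spoil too few indices to exhaust the family\<close>
  have "|\<Union>i\<in>D. spoiled (f i)| \<le>o |Pow X|"
    by (rule card_of_UNION_ordLeq_infinite[OF PowX_infinite ordLeq_Pow_self[OF DX]])
      (use goodD(8)[OF good] in blast)
  then have "\<not> S \<subseteq> (\<Union>i\<in>D. spoiled (f i))" using S ordLeq_subset by blast
  then obtain j where j: "j \<in> S" "\<And>i. i \<in> D \<Longrightarrow> j \<notin> spoiled (f i)" by blast
  have aj: "a j \<in> J \<rightarrow>\<^sub>E univ R"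
    using fam j(1) le_univ[OF PP[OF R(1)]] by (auto simp: asymmetric_family_def)
  obtain M0 where M0: "le K M0 NN" "|univ M0| \<le>o |Y|" "free J (incl_arrow M0 NN) (incl_arrow NN R) (a j)"
    using local_character_free[OF NNR aj] by blast
  have "\<exists>i\<in>Field d. univ M0 \<subseteq> univ (?N' i)"
  proof (rule regularCard_UNION[OF d reg])
    show "relChain d (\<lambda>i. univ (?N' i))" unfolding relChain_def using mono(2) by blast
    show "univ M0 \<subseteq> (\<Union>i\<in>Field d. univ (?N' i))"
      using le_univ[OF M0(1)] unfolding NN_def union_struct_def Fd by simp
    show "|univ M0| <o d" by (rule ordLeq_ordLess_trans[OF M0(2) Yd])
  qed
  then obtain i where i: "i \<in> D" "univ M0 \<subseteq> univ (?N' i)" unfolding Fd by blast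
  obtain k where k: "k \<in> D" "i \<in> underS d k"
    using infinite_Card_order_limit[OF d, of i] Dinf i(1) unfolding Fd underS_def by blast
  \<comment> \<open>one stage later \<open>M0\<close> is contained in an inner model, over which a forking step was made\<close>
  let ?Nk = "inner (f k)"
  have NkN': "le K ?Nk (?N' k)" by (rule goodD(5)[OF good[OF k(1)]])
  have NkN: "le K ?Nk NN" by (rule le_trans[OF NkN' N'N[OF k(1)]])
  have M0k: "le K M0 ?Nk"
    using le_coherent[OF M0(1) NkN] i(2) below[OF k] unfolding below_def by blast
  have "free J (incl_arrow ?Nk NN \<cdot> incl_arrow M0 ?Nk) (incl_arrow NN R) (a j)"
    using M0(3) comp_incl[OF M0k NkN] by simp
  then have "free J (incl_arrow ?Nk NN) (incl_arrow NN R) (a j)"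
    by (rule free_base_mono) (simp_all add: arr_incl M0k NkN)
  then have "free J (incl_arrow (?N' k) NN \<cdot> incl_arrow ?Nk (?N' k)) (incl_arrow NN R) (a j)"
    using comp_incl[OF NkN' N'N[OF k(1)]] by simp
  then have "free J (incl_arrow ?Nk (?N' k)) (incl_arrow NN R \<cdot> incl_arrow (?N' k) NN) (a j)"
    by (rule free_mono) (simp_all add: arr_incl NkN' N'N[OF k(1)])
  then have "free J (incl_arrow ?Nk (?N' k)) (incl_arrow (?N' k) R) (a j)"
    using comp_incl[OF N'N[OF k(1)] NNR] by simp
  with goodD(9)[OF good[OF k(1)] _ R(2)[OF k(1)]] j k(1) show False by blast
qed

end

context mu_AEC
begin

lemma small_copy_of_Pow:
  assumes "small (A :: 'u set)"
  obtains B :: "'u set" where "|B| =o |Pow A|" "small B"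
  using small_copy[OF small_Pow[OF assms]] by blast

lemma small_Un: "small (A :: 'u set) \<Longrightarrow> small B \<Longrightarrow> small (A \<union> B)"
  unfolding small_def by (rule card_of_Un_ordLess_infinite[OF infinite_universe])

end

context independence
begin

text \<open>
  Distinct indices are comparable, so the order property separates each pair of distinct indices
  from its reverse, whichever of the two indices comes first.
\<close>

lemma asymmetric_family_of_order:
  assumes M: "M \<in> models K" and a: "\<And>i. i \<in> W \<Longrightarrow> a i \<in> J \<rightarrow>\<^sub>E univ M"
    and ne: "\<And>i j. j \<in> W \<Longrightarrow> i \<in> underS |W| j \<Longrightarrow>
      gtp K (J <+> J) (case_sum (a i) (a j)) {} M \<noteq> gtp K (J <+> J) (case_sum (a j) (a i)) {} M"
    and R: "le K M R" "le K N R" and ij: "i \<in> W" "j \<in> W" "i \<noteq> j"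
  shows "\<not> same_type (J <+> J) (incl_arrow N R) (case_sum (a i) (a j)) (incl_arrow N R) (case_sum (a j) (a i))"
proof
  assume st: "same_type (J <+> J) (incl_arrow N R) (case_sum (a i) (a j)) (incl_arrow N R) (case_sum (a j) (a i))"
  have mem: "case_sum (a k) (a l) \<in> J <+> J \<rightarrow>\<^sub>E univ M" if "k \<in> W" "l \<in> W" for k l
    using a[OF that(1)] a[OF that(2)] by (auto simp: PiE_iff extensional_def split: sum.split)
  have memR: "case_sum (a k) (a l) \<in> J <+> J \<rightarrow>\<^sub>E univ R" if "k \<in> W" "l \<in> W" for k l
    using mem[OF that] le_univ[OF R(1)] by (auto simp: PiE_iff)
  have incl: "gtp_step K (J <+> J) (case_sum (a k) (a l), {}, M) (case_sum (a k) (a l), {}, R)"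
    if "k \<in> W" "l \<in> W" for k l
    unfolding gtp_step_iff
    using mem[OF that] memR[OF that] M le_modelsD(2)[OF R(1)] R(1)
    by (intro conjI exI[of _ "incl_arrow M R"] exI[of _ "incl_arrow R R"])
      (auto simp: arr_incl arr_id PiE_iff)
  obtain g g' where "arr g" "arr g'" "src g = R" "src g' = R" "tgt g = tgt g'"
    "\<And>k. k \<in> J <+> J \<Longrightarrow> map_of_arrow g (case_sum (a i) (a j) k) = map_of_arrow g' (case_sum (a j) (a i) k)"
    using st unfolding same_type_def incl_tgt by blast
  then have "gtp_step K (J <+> J) (case_sum (a i) (a j), {}, R) (case_sum (a j) (a i), {}, R)"
    unfolding gtp_step_iff using memR ij le_modelsD(2)[OF R(1)] by blast
  then have "gtp_step K (J <+> J) (case_sum (a i) (a j), {}, M) (case_sum (a j) (a i), {}, M)"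
    using gtp_step_trans[OF gtp_step_trans[OF incl[OF ij(1,2)]] gtp_step_sym[OF incl[OF ij(2,1)]]] by blast
  then have eq: "gtp K (J <+> J) (case_sum (a i) (a j)) {} M = gtp K (J <+> J) (case_sum (a j) (a i)) {} M"
    using gtp_eq_iff[OF M mem[OF ij(2,1)], of "{}"] by simp
  have "i \<in> underS |W| j \<or> j \<in> underS |W| i"
    using card_of_well_order_on[of W] ij
    by (auto simp: well_order_on_def linear_order_on_def total_on_def underS_def)
  then show False using ne[OF ij(2), of i] ne[OF ij(1), of j] eq by auto
qed

lemma no_order_property:
  assumes lc: "right_local_character K ind" and cases: "chain_bounds K \<or> symmetric ind"
  shows "\<not> order_property K"
proof
  assume "order_property K"
  then obtain \<alpha> where \<alpha>: "is_ordinal \<alpha>" and op: "\<And>\<theta>. is_ordinal \<theta> \<Longrightarrow> order_property_of_length K \<alpha> \<theta>"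
    unfolding order_property_def by blast
  define J where "J = Field \<alpha>"
  have J: "small J" using \<alpha> by (simp add: J_def is_ordinal_def)
  have "is_cardinal |J|" using J by (simp add: is_cardinal_def Field_card_of card_of_card_order_on)
  then obtain m :: "'u rel" where m: "is_cardinal m" and lc': "\<And>M p. M \<in> models K \<Longrightarrow> p \<in> gS K J M \<Longrightarrow>
      \<exists>M0. le K M0 M \<and> |univ M0| \<le>o m \<and> nonforking K ind J (univ M) p M0"
    using lc[unfolded right_local_character_def, rule_format, of "|J|", unfolded Field_card_of] by blast
  have "LST_axiom K" using mu_AEC by (simp add: is_mu_AEC_def)
  then obtain l :: "'u rel" where lst: "is_cardinal l \<and> l =o |seqs_less (mu K) (Field l)| \<and>
      |rel_syms K \<union> fun_syms K| +c mu K \<le>o l \<and>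
      (\<forall>M \<in> models K. \<forall>A \<subseteq> univ M.
         \<exists>M0. le K M0 M \<and> A \<subseteq> univ M0 \<and> |univ M0| \<le>o |seqs_less (mu K) A| +c l)"
    unfolding LST_axiom_def by (rule exE)
  note l = lst[THEN conjunct1] lst[THEN conjunct2, THEN conjunct2, THEN conjunct1]
  have LST: "\<exists>M0. le K M0 M \<and> A \<subseteq> univ M0 \<and> |univ M0| \<le>o |seqs_less (mu K) A| +c l"
    if "M \<in> models K" "A \<subseteq> univ M" for M A
    by (rule lst[THEN conjunct2, THEN conjunct2, THEN conjunct2, rule_format, OF that])
  have mu: "is_regular_cardinal (mu K)" using mu_AEC by (simp add: is_mu_AEC_def)
  \<comment> \<open>one set that bounds all cardinals in play\<close>
  define Y where "Y = Field (mu K) \<union> Field l \<union> Field m \<union> J"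
  have Y: "small Y" unfolding Y_def
    by (intro small_Un J) (use l(1) m mu in \<open>auto simp: is_regular_cardinal_def is_cardinal_def\<close>)
  have Yinf: "\<not> finite Y" using mu by (auto simp: Y_def is_regular_cardinal_def cinfinite_def)
  have leY: "r \<le>o |Y|" if "is_cardinal r" "Field r \<subseteq> Y" for r
    using that ordIso_ordLeq_trans[OF ordIso_symmetric[OF card_of_Field_ordIso] card_of_mono1]
    by (auto simp: is_cardinal_def)
  have lY: "l \<le>o |Y|" and mY: "m \<le>o |Y|" by (rule leY; use l(1) m in \<open>auto simp: Y_def\<close>)+
  obtain X :: "'u set" where X: "|X| =o |Pow Y|" "small X" using small_copy_of_Pow[OF Y] by blast
  obtain X2 :: "'u set" where X2: "|X2| =o |Pow X|" "small X2" using small_copy_of_Pow[OF X(2)] by blast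
  obtain W :: "'u set" where W: "|W| =o |Pow X2|" "small W" using small_copy_of_Pow[OF X2(2)] by blast
  have W_large: "\<not> |W| \<le>o |Pow X|"
  proof
    assume "|W| \<le>o |Pow X|"
    then have "|Pow X2| \<le>o |X2|"
      using W(1) X2(1) ordIso_ordLeq_trans ordLeq_ordIso_trans ordIso_symmetric by blast
    then show False using card_of_Pow not_ordLess_ordLeq by blast
  qed
  interpret bounded_independence K ind J Y X
  proof unfold_locales
    show "|Field (mu K)| \<le>o |Y|" "|J| \<le>o |Y|" by (auto simp: Y_def intro: card_of_mono1)
    show "|rel_syms K \<union> fun_syms K| \<le>o |Y|"
      using ordLeq_transitive[OF ordLeq_transitive[OF ordLeq_csum1 l(2)] lY] card_of_Card_order by blast
    show "\<exists>M0. le K M0 M \<and> A \<subseteq> univ M0 \<and> |univ M0| \<le>o |seqs_less (mu K) A| +c |Y|"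
      if "M \<in> models K" "A \<subseteq> univ M" for M A
      using LST[OF that] ordLeq_transitive[OF _ csum_mono2[OF lY]] by blast
    show "\<exists>M0. le K M0 M \<and> |univ M0| \<le>o |Y| \<and> nonforking K ind J (univ M) p M0"
      if "M \<in> models K" "p \<in> gS K J M" for M p
      using lc'[OF that] ordLeq_transitive[OF _ mY] by blast
  qed (fact Yinf X(1))+
  have "is_ordinal |W|" using W(2) by (simp add: is_ordinal_def Field_card_of card_of_well_order_on)
  from op[OF this] obtain M a where "M \<in> models K" "\<forall>i\<in>W. a i \<in> J \<rightarrow>\<^sub>E univ M"
    and ne': "\<forall>i0 j0 i1 j1. j0 \<in> W \<and> i0 \<in> underS |W| j0 \<and> j1 \<in> W \<and> i1 \<in> underS |W| j1 \<longrightarrow>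
      gtp K (J <+> J) (case_sum (a i0) (a j0)) {} M \<noteq> gtp K (J <+> J) (case_sum (a j1) (a i1)) {} M"
    unfolding order_property_of_length_def J_def[symmetric] Field_card_of by (elim bexE exE conjE)
  then have M: "M \<in> models K" "\<And>i. i \<in> W \<Longrightarrow> a i \<in> J \<rightarrow>\<^sub>E univ M" by auto
  have ne: "gtp K (J <+> J) (case_sum (a i) (a j)) {} M \<noteq> gtp K (J <+> J) (case_sum (a j) (a i)) {} M"
    if "j \<in> W" "i \<in> underS |W| j" for i j
    by (rule ne'[rule_format]) (simp add: that)
  have fam: "asymmetric_family M W a"
    unfolding asymmetric_family_def
    by (intro conjI ballI allI impI; (elim conjE)?)
      (erule M(2), rule asymmetric_family_of_order[OF M ne], assumption+)
  from cases show False
  proof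
    assume cb: "chain_bounds K"
    show False
    proof (rule no_large_asymmetric_family[OF X(2) fam W_large, of "le K M"])
      show "le K M M" by (rule le_refl[OF M(1)])
      show "\<exists>R. le K M R \<and> (\<forall>i\<in>Field d. le K (N i) R)"
        if d: "is_ordinal d" "\<And>i. i \<in> Field d \<Longrightarrow> le K M (N i)" "\<And>i j. (i, j) \<in> d \<Longrightarrow> le K (N i) (N j)"
        for d :: "'u rel" and N
      \<comment> \<open>an arbitrary bound of the empty chain would not extend \<open>M\<close>\<close>
      proof (cases "Field d = {}")
        case True
        then show ?thesis using le_refl[OF M(1)] by blast
      next
        case False
        obtain R where R: "\<forall>i\<in>Field d. le K (N i) R"
          using cb[unfolded chain_bounds_def, rule_format, of d N] d(1,3) le_modelsD(2)[OF d(2)] by blast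
        with False d(2) show ?thesis using le_trans by blast
      qed
      show "\<exists>P' N' E. le K M P' \<and> forking_step W a P N P' N' E"
        if P: "le K M P" "le K N P" "|univ N| \<le>o |Pow X|" for P N
        using forking_step_extension[OF fam P] le_trans[OF P(1)] unfolding forking_step_def by blast
    qed
  next
    assume sym: "symmetric ind"
    show False
    proof (rule no_large_asymmetric_family[OF X(2) fam W_large, of "\<lambda>P. P = M"])
      show "\<exists>R. R = M \<and> (\<forall>i\<in>Field d. le K (N i) R)"
        if "\<And>i. i \<in> Field d \<Longrightarrow> N i = M" for d :: "'u rel" and N
        using that le_refl[OF M(1)] by auto
      show "\<exists>P' N' E. P' = M \<and> forking_step W a P N P' N' E"
        if P: "P = M" "le K N P" "|univ N| \<le>o |Pow X|" for P N
        using forking_step_symmetric[OF sym fam le_refl[OF M(1)], of N] P by blast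
    qed (auto intro: le_refl M(1))
  qed
qed

end

theorem theorem9p8:
  fixes K :: "('s, 'u) abstract_class"
    and ind :: "('s, 'u) square_pred"
  assumes "inaccessible_universe TYPE('u)"
    and "is_mu_AEC K"
    and "independence_relation K ind"
    and "invariant K ind"
    and "transitive ind"
    and "has_existence K ind"
    and "has_uniqueness K ind"
    and "right_local_character K ind"
    and "chain_bounds K \<or> symmetric ind"
  shows "\<not> order_property K"
proof -
  interpret independence K ind by unfold_locales fact+
  show ?thesis by (rule no_order_property) fact+
qed

end
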